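(* Consider the Markovian proximal Bellman-ADMM iteration described in the context, under the coverage/observation assumption and the algorithmic-margin assumption stated there. Then there are deterministic constants $C_\pi,C_V,C_\varepsilon>0$, not depending on $k$ or on the batch schedule $(m_k)$, such that for every $k\ge 1$ $$\mathbb E\|\Delta\lambda_{k+1}\|^2\le C_\pi\,\mathbb E\|\Delta\pi_{k+1}\|^2+C_V\,\mathbb E\|\Delta V_{k+1}\|^2+C_V\,\mathbb E\|\Delta V_k\|^2+C_\varepsilon\Big(\frac1{m_k}+\frac1{m_{k-1}}\Big).$$ One valid choice for the deterministic primal coefficients is $C_\pi=5\bar\kappa^4L_M^2\|c\|^2$ and $C_V=5\bar\kappa^2/\eta_V^2$.
   Context: Norms are Euclidean for vectors and spectral for matrices. MDP: $(\mathcal S,\mathcal A,P,r,\rho,\gamma)$ is a finite discounted MDP with $0<\gamma<1$. Policies are $\pi\in\Pi=\prod_{s\in\mathcal S}\Delta(\mathcal A)\subset\mathbb R^{|\mathcal S||\mathcal A|}$. Set $P_\pi(s,s')=\sum_a\pi(a|s)P(s'|s,a)$, $r_\pi(s)=\sum_a\pi(a|s)r(s,a)$, $M_\pi=I-\gamma P_\pi$, $R(\pi,V)=M_\pi V-r_\pi$ for $V\in\mathbb R^{|\mathcal S|}$. The problem is $\min_{\pi\in\Pi,V}\phi(\pi)+c^{\mathsf T}V$ subject to $R(\pi,V)=0$, where $c\in\mathbb R^{|\mathcal S|}$ and $\phi$ (possibly nonsmooth, nonconvex) is proper, lower semicontinuous and bounded below on $\Pi$ with $\operatorname{dom}\phi\cap\Pi\neq\varnothing$;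 $\psi=\phi+\delta_\Pi$ with $\delta_\Pi$ the indicator of $\Pi$. The augmented Lagrangian is $\mathcal L_\beta(\pi,V,\lambda)=\phi(\pi)+c^{\mathsf T}V+\langle\lambda,R(\pi,V)\rangle+\frac\beta2\|R(\pi,V)\|^2$. Sampling: at outer iteration $k$ an exploratory behavior policy $\bar\pi^k$ is frozen and a batch of $m_k\geq 1$ steps of the reset chain with kernel $K_k(s,s')=(1-\gamma)\rho(s')+\gamma P_{\bar\pi^k}(s,s')$ is simulated: at step $t$, in state $S_{k,t}$, an action $A_{k,t}\sim\bar\pi^k(\cdot|S_{k,t})$ and a reset indicator (reset with probability $1-\gamma$) are drawn; on a reset the next state is drawn from $\rho$, otherwise an environment transition from $P(\cdot|S_{k,t},A_{k,t})$ is observed with reward observation $Y_{k,t}$. From the non-reset transitions of batch $k$ only, form the empirical conditional transition rows $\widehat P_k(\cdot|s,a)$ and average observed rewards $\widehat r_k(s,a)$ for each $(s,a)$; an unvisited transition row is replaced by a fixed probability vector and an unvisited reward entry by a fixed bounded value. Set $\widehat P_{\pi,k}(s,\cdot)=\sum_a\pi(a|s)\widehat P_k(\cdot|s,a)$, $\widehat r_{\pi,k}(s)=\sum_a\pi(a|s)\widehat r_k(s,a)$, $\widehat M_{\pi,k}=I-\gamma\widehat P_{\pi,k}$, $\widehat R_k(\pi,V)=\widehat M_{\pi,k}V-\widehat r_{\pi,k}$, and let $\widehat{\mathcal L}_{\beta,k}$ be $\mathcal L_\beta$ with $R$ replaced by $\widehat R_k$. The constant $\bar\kappa<\infty$ satisfies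 $\|M_\pi^{-1}\|\le\bar\kappa$ and $\|\widehat M_{\pi,k}^{-1}\|\le\bar\kappa$ for all $\pi,k$ and all realizations (it exists since all rows are stochastic). Algorithm: from $(\pi^0,V^0,\lambda^0)$, with $\beta,\eta_\pi,\eta_V>0$, for $k=0,1,\dots$: $\pi^{k+1}\in\arg\min_{\pi\in\Pi}\{\widehat{\mathcal L}_{\beta,k}(\pi,V^k,\lambda^k)+\frac1{2\eta_\pi}\|\pi-\pi^k\|^2\}$; $V^{k+1}=\arg\min_V\{\widehat{\mathcal L}_{\beta,k}(\pi^{k+1},V,\lambda^k)+\frac1{2\eta_V}\|V-V^k\|^2\}$; $\lambda^{k+1}=\lambda^k+\beta\widehat R_k(\pi^{k+1},V^{k+1})$. Write $\Delta\pi_{k+1}=\pi^{k+1}-\pi^k$, and similarly $\Delta V_{k+1},\Delta\lambda_{k+1}$. All of $(\pi^k,V^k,\lambda^k,\bar\pi^k)$ is determined before batch $k$ is drawn (measurable with respect to the sigma-field $\mathcal F_k$ of the history before batch $k$). Coverage/observation assumption: there are $\rho_{\min},\alpha>0$, $R_{\max}<\infty$ with $\rho(s)\ge\rho_{\min}$, $\bar\pi^k(a|s)\ge\alpha$, $|r(s,a)|\le R_{\max}$ for all $k,s,a$. Moreover $Y_{k,t}=r(S_{k,t},A_{k,t})+\zeta_{k,t}$ with $\mathbb E[\zeta_{k,t}|\mathcal G_{k,t}]=0$ and $\mathbb E[|\zeta_{k,t}|^4|\mathcal G_{k,t}]\le M_4<\infty$, where $\mathcal G_{k,t}$ contains all past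 observations and the current state, action and reset indicator, before the current reward and next state are drawn. Fresh reset coins, reset states and action randomization are independent of the preceding history; on non-reset steps the conditional next-state law is $P(\cdot|S_{k,t},A_{k,t})$; the current reward and next state may be dependent. Algorithmic-margin assumption: the policy subproblem admits a global minimizer and is solved exactly; the value subproblem is solved exactly; $\pi^0$ is deterministic and lies in $\operatorname{dom}\psi$; $\|M_{\pi'}-M_\pi\|\le L_M\|\pi'-\pi\|$ for some $L_M<\infty$; $b(\pi)=\phi(\pi)+c^{\mathsf T}M_\pi^{-1}r_\pi$ is bounded below on $\Pi$; $\beta>\max\{60\bar\kappa^2/\eta_V,\;30\eta_\pi\bar\kappa^4L_M^2\|c\|^2\}$ and $\tau=1/(8\eta_V)$; $\mathbb E\|V^0\|^4+\mathbb E\|\lambda^0\|^4<\infty$. *)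

theory Defs
  imports "HOL-Probability.Probability"
begin

section \<open>Finite discounted MDPs and the Bellman residual\<close>

definition prob_vector :: "('i::finite \<Rightarrow> real) \<Rightarrow> bool" where
  "prob_vector p \<longleftrightarrow> (\<forall>i. 0 \<le> p i) \<and> (\<Sum>i\<in>UNIV. p i) = 1"

record ('s, 'a) mdp =
  transition :: "'s \<Rightarrow> 'a \<Rightarrow> 's \<Rightarrow> real"
  reward :: "'s \<Rightarrow> 'a \<Rightarrow> real"
  reset_dist :: "'s \<Rightarrow> real"
  discount :: real

definition is_mdp :: "('s::finite, 'a::finite) mdp \<Rightarrow> bool" where
  "is_mdp D \<longleftrightarrow> 0 < discount D \<and> discount D < 1 \<and>
     (\<forall>s a. prob_vector (transition D s a)) \<and> prob_vector (reset_dist D)"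

text \<open>A policy is an element of \<open>real^'a^'s\<close>, with \<open>\<pi> $ s $ a\<close> standing for \<open>\<pi>(a|s)\<close>. The norm of
  this type is the Euclidean norm of the vector of all its entries.\<close>

definition policies :: "(real^'a::finite^'s::finite) set" where
  "policies = {\<pi>. \<forall>s. prob_vector (\<lambda>a. \<pi> $ s $ a)}"

text \<open>The following notions take the transition rows \<open>Q\<close> and the rewards \<open>q\<close> as arguments, so that they
  serve both for the true model and for the empirical model of a batch.\<close>

definition P_pol :: "('s::finite \<Rightarrow> 'a::finite \<Rightarrow> 's \<Rightarrow> real) \<Rightarrow> real^'a^'s \<Rightarrow> real^'s^'s" where
  "P_pol Q \<pi> = (\<chi> s s'. \<Sum>a\<in>UNIV. \<pi> $ s $ a * Q s a s')"

definition r_pol :: "('s::finite \<Rightarrow> 'a::finite \<Rightarrow> real) \<Rightarrow> real^'a^'s \<Rightarrow> real^'s" where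
  "r_pol q \<pi> = (\<chi> s. \<Sum>a\<in>UNIV. \<pi> $ s $ a * q s a)"

definition M_pol ::
    "real \<Rightarrow> ('s::finite \<Rightarrow> 'a::finite \<Rightarrow> 's \<Rightarrow> real) \<Rightarrow> real^'a^'s \<Rightarrow> real^'s^'s" where
  "M_pol \<gamma> Q \<pi> = mat 1 - \<gamma> *\<^sub>R P_pol Q \<pi>"

definition bellman_residual ::
    "real \<Rightarrow> ('s::finite \<Rightarrow> 'a::finite \<Rightarrow> 's \<Rightarrow> real) \<Rightarrow> ('s \<Rightarrow> 'a \<Rightarrow> real) \<Rightarrow>
     real^'a^'s \<Rightarrow> real^'s \<Rightarrow> real^'s" where
  "bellman_residual \<gamma> Q q \<pi> V = M_pol \<gamma> Q \<pi> *v V - r_pol q \<pi>"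

definition aug_lagrangian ::
    "(real^'a^'s \<Rightarrow> ereal) \<Rightarrow> real^'s \<Rightarrow> real \<Rightarrow>
     real \<Rightarrow> ('s::finite \<Rightarrow> 'a::finite \<Rightarrow> 's \<Rightarrow> real) \<Rightarrow> ('s \<Rightarrow> 'a \<Rightarrow> real) \<Rightarrow>
     real^'a^'s \<Rightarrow> real^'s \<Rightarrow> real^'s \<Rightarrow> ereal" where
  "aug_lagrangian \<phi> c \<beta> \<gamma> Q q \<pi> V \<Lambda> =
     \<phi> \<pi> + ereal (c \<bullet> V + \<Lambda> \<bullet> bellman_residual \<gamma> Q q \<pi> V
                 + \<beta> / 2 * (norm (bellman_residual \<gamma> Q q \<pi> V))\<^sup>2)"

definition spectral_norm :: "real^'n::finite^'m::finite \<Rightarrow> real" where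
  "spectral_norm A = onorm (\<lambda>x. A *v x)"

section \<open>Extended-valued functions\<close>

definition proper_fun :: "('x \<Rightarrow> ereal) \<Rightarrow> bool" where
  "proper_fun f \<longleftrightarrow> (\<forall>x. f x \<noteq> -\<infinity>) \<and> (\<exists>x. f x \<noteq> \<infinity>)"

definition effective_dom :: "('x \<Rightarrow> ereal) \<Rightarrow> 'x set" where
  "effective_dom f = {x. f x < \<infinity>}"

definition lsc_on :: "'x::topological_space set \<Rightarrow> ('x \<Rightarrow> ereal) \<Rightarrow> bool" where
  "lsc_on S f \<longleftrightarrow> (\<forall>x\<in>S. f x \<le> Liminf (at x within S) f)"

definition bounded_below_on :: "'x set \<Rightarrow> ('x \<Rightarrow> ereal) \<Rightarrow> bool" where
  "bounded_below_on S f \<longleftrightarrow> (\<exists>B::real. \<forall>x\<in>S. ereal B \<le> f x)"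

definition indicator_fun :: "'x set \<Rightarrow> 'x \<Rightarrow> ereal" where
  "indicator_fun S x = (if x \<in> S then 0 else \<infinity>)"

definition psi_fun :: "(real^'a::finite^'s::finite \<Rightarrow> ereal) \<Rightarrow> real^'a^'s \<Rightarrow> ereal" where
  "psi_fun \<phi> \<pi> = \<phi> \<pi> + indicator_fun policies \<pi>"

definition reduced_objective ::
    "('s::finite, 'a::finite) mdp \<Rightarrow> (real^'a^'s \<Rightarrow> ereal) \<Rightarrow> real^'s \<Rightarrow> real^'a^'s \<Rightarrow> ereal" where
  "reduced_objective D \<phi> c \<pi> =
     \<phi> \<pi> + ereal (c \<bullet> (matrix_inv (M_pol (discount D) (transition D) \<pi>) *v r_pol (reward D) \<pi>))"

section \<open>Batches, empirical models and the iteration\<close>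

text \<open>
  All random objects of one run, as functions on a sample space \<open>'w\<close>. In batch \<open>k\<close>, step \<open>t\<close> leads from
  \<open>state X k t\<close> to \<open>state X k (Suc t)\<close>; \<open>reset X k t\<close> is true iff the step is a reset.

  Three families of sigma-fields record the history, interleaved as
  \<open>hist k \<subseteq> pre k 0 \<subseteq> post k 0 \<subseteq> pre k 1 \<subseteq> \<dots> \<subseteq> pre k (m k) \<subseteq> hist (k + 1)\<close>:
  \<open>hist X k\<close> is \<open>F_k\<close>, the history before batch \<open>k\<close>; \<open>pre X k t\<close> is the history up to and including the
  state at step \<open>t\<close>, before the action and the reset coin are drawn; \<open>post X k t\<close> is \<open>G_(k,t)\<close>, which also
  contains this action and coin, but not the current reward and next state.
\<close>

record ('w, 's, 'a) run =
  pol :: "nat \<Rightarrow> 'w \<Rightarrow> real^'a^'s"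
  val :: "nat \<Rightarrow> 'w \<Rightarrow> real^'s"
  mult :: "nat \<Rightarrow> 'w \<Rightarrow> real^'s"
  behav :: "nat \<Rightarrow> 'w \<Rightarrow> real^'a^'s"
  state :: "nat \<Rightarrow> nat \<Rightarrow> 'w \<Rightarrow> 's"
  action :: "nat \<Rightarrow> nat \<Rightarrow> 'w \<Rightarrow> 'a"
  reset :: "nat \<Rightarrow> nat \<Rightarrow> 'w \<Rightarrow> bool"
  obs :: "nat \<Rightarrow> nat \<Rightarrow> 'w \<Rightarrow> real"
  hist :: "nat \<Rightarrow> 'w measure"
  pre :: "nat \<Rightarrow> nat \<Rightarrow> 'w measure"
  post :: "nat \<Rightarrow> nat \<Rightarrow> 'w measure"

definition history_fields ::
    "'w measure \<Rightarrow> (nat \<Rightarrow> nat) \<Rightarrow> ('w, 's::finite, 'a::finite) run \<Rightarrow> bool" where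
  "history_fields M m X \<longleftrightarrow>
     (\<forall>k. subalgebra M (hist X k)) \<and>
     (\<forall>k. subalgebra (pre X k 0) (hist X k)) \<and>
     (\<forall>k. \<forall>t<m k. subalgebra (post X k t) (pre X k t) \<and> subalgebra (pre X k (Suc t)) (post X k t)) \<and>
     (\<forall>k. subalgebra (hist X (Suc k)) (pre X k (m k)))"

definition adapted_run ::
    "(nat \<Rightarrow> nat) \<Rightarrow> ('w, 's::finite, 'a::finite) run \<Rightarrow> bool" where
  "adapted_run m X \<longleftrightarrow>
     (\<forall>k. pol X k \<in> borel_measurable (hist X k) \<and> val X k \<in> borel_measurable (hist X k) \<and>
          mult X k \<in> borel_measurable (hist X k) \<and> behav X k \<in> borel_measurable (hist X k)) \<and>
     (\<forall>k. \<forall>t\<le>m k. state X k t \<in> measurable (pre X k t) (count_space UNIV)) \<and>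
     (\<forall>k. \<forall>t<m k. action X k t \<in> measurable (post X k t) (count_space UNIV) \<and>
                  reset X k t \<in> measurable (post X k t) (count_space UNIV) \<and>
                  obs X k t \<in> borel_measurable (pre X k (Suc t)))"

text \<open>
  The laws of the reset chain. The coin is independent of the history and of the action, hence the product
  in the joint conditional law of the two. The law of the initial state of a batch is left unspecified.
\<close>

definition reset_chain ::
    "('s::finite, 'a::finite) mdp \<Rightarrow> 'w measure \<Rightarrow> (nat \<Rightarrow> nat) \<Rightarrow> ('w, 's, 'a) run \<Rightarrow> bool" where
  "reset_chain D M m X \<longleftrightarrow>
     (\<forall>k. \<forall>\<omega>\<in>space M. behav X k \<omega> \<in> policies) \<and>
     (\<forall>k. \<forall>t<m k. \<forall>a u. AE \<omega> in M.
        real_cond_exp M (pre X k t)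
            (indicator {\<omega>' \<in> space M. action X k t \<omega>' = a \<and> reset X k t \<omega>' = u}) \<omega> =
          behav X k \<omega> $ state X k t \<omega> $ a * (if u then 1 - discount D else discount D)) \<and>
     (\<forall>k. \<forall>t<m k. \<forall>s'. AE \<omega> in M.
        real_cond_exp M (post X k t) (indicator {\<omega>' \<in> space M. state X k (Suc t) \<omega>' = s'}) \<omega> =
          (if reset X k t \<omega> then reset_dist D s'
           else transition D (state X k t \<omega>) (action X k t \<omega>) s'))"

definition noise ::
    "('s::finite, 'a::finite) mdp \<Rightarrow> ('w, 's, 'a) run \<Rightarrow> nat \<Rightarrow> nat \<Rightarrow> 'w \<Rightarrow> real" where
  "noise D X k t \<omega> = obs X k t \<omega> - reward D (state X k t \<omega>) (action X k t \<omega>)"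

text \<open>The nonnegative conditional expectation is meaningful without integrability, so that the bound on the
  fourth conditional moment entails that the noise is integrable.\<close>

definition noise_moments ::
    "('s::finite, 'a::finite) mdp \<Rightarrow> real \<Rightarrow> 'w measure \<Rightarrow> (nat \<Rightarrow> nat) \<Rightarrow> ('w, 's, 'a) run \<Rightarrow> bool" where
  "noise_moments D M4 M m X \<longleftrightarrow>
     (\<forall>k. \<forall>t<m k.
        (AE \<omega> in M. real_cond_exp M (post X k t) (noise D X k t) \<omega> = 0) \<and>
        (AE \<omega> in M. nn_cond_exp M (post X k t) (\<lambda>\<omega>'. ennreal (\<bar>noise D X k t \<omega>'\<bar> ^ 4)) \<omega> \<le> ennreal M4))"

definition visits ::
    "(nat \<Rightarrow> nat) \<Rightarrow> ('w, 's::finite, 'a::finite) run \<Rightarrow> nat \<Rightarrow> 'w \<Rightarrow> 's \<Rightarrow> 'a \<Rightarrow> nat set" where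
  "visits m X k \<omega> s a = {t. t < m k \<and> \<not> reset X k t \<omega> \<and> state X k t \<omega> = s \<and> action X k t \<omega> = a}"

text \<open>\<open>P0 s a\<close> and \<open>r0 s a\<close> are the fixed values used for an unvisited pair.\<close>

definition P_hat ::
    "('s::finite \<Rightarrow> 'a::finite \<Rightarrow> 's \<Rightarrow> real) \<Rightarrow> (nat \<Rightarrow> nat) \<Rightarrow> ('w, 's, 'a) run \<Rightarrow> nat \<Rightarrow> 'w \<Rightarrow>
     's \<Rightarrow> 'a \<Rightarrow> 's \<Rightarrow> real" where
  "P_hat P0 m X k \<omega> s a s' =
     (if visits m X k \<omega> s a = {} then P0 s a s'
      else real (card {t \<in> visits m X k \<omega> s a. state X k (Suc t) \<omega> = s'}) / real (card (visits m X k \<omega> s a)))"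

definition r_hat ::
    "('s::finite \<Rightarrow> 'a::finite \<Rightarrow> real) \<Rightarrow> (nat \<Rightarrow> nat) \<Rightarrow> ('w, 's, 'a) run \<Rightarrow> nat \<Rightarrow> 'w \<Rightarrow>
     's \<Rightarrow> 'a \<Rightarrow> real" where
  "r_hat r0 m X k \<omega> s a =
     (if visits m X k \<omega> s a = {} then r0 s a
      else (\<Sum>t\<in>visits m X k \<omega> s a. obs X k t \<omega>) / real (card (visits m X k \<omega> s a)))"

definition admm_iteration ::
    "('s::finite, 'a::finite) mdp \<Rightarrow> (real^'a^'s \<Rightarrow> ereal) \<Rightarrow> real^'s \<Rightarrow> real \<Rightarrow> real \<Rightarrow> real \<Rightarrow>
     ('s \<Rightarrow> 'a \<Rightarrow> 's \<Rightarrow> real) \<Rightarrow> ('s \<Rightarrow> 'a \<Rightarrow> real) \<Rightarrow>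
     'w measure \<Rightarrow> (nat \<Rightarrow> nat) \<Rightarrow> ('w, 's, 'a) run \<Rightarrow> bool" where
  "admm_iteration D \<phi> c \<beta> \<eta>\<^sub>\<pi> \<eta>\<^sub>V P0 r0 M m X \<longleftrightarrow>
     (\<forall>k. \<forall>\<omega>\<in>space M.
        let Lhat = aug_lagrangian \<phi> c \<beta> (discount D) (P_hat P0 m X k \<omega>) (r_hat r0 m X k \<omega>);
            Rhat = bellman_residual (discount D) (P_hat P0 m X k \<omega>) (r_hat r0 m X k \<omega>)
        in is_arg_min
             (\<lambda>\<pi>. Lhat \<pi> (val X k \<omega>) (mult X k \<omega>) + ereal (1 / (2 * \<eta>\<^sub>\<pi>) * (norm (\<pi> - pol X k \<omega>))\<^sup>2))
             (\<lambda>\<pi>. \<pi> \<in> policies) (pol X (Suc k) \<omega>) \<and>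
           is_arg_min
             (\<lambda>V. Lhat (pol X (Suc k) \<omega>) V (mult X k \<omega>) + ereal (1 / (2 * \<eta>\<^sub>V) * (norm (V - val X k \<omega>))\<^sup>2))
             (\<lambda>V. True) (val X (Suc k) \<omega>) \<and>
           mult X (Suc k) \<omega> = mult X k \<omega> + \<beta> *\<^sub>R Rhat (pol X (Suc k) \<omega>) (val X (Suc k) \<omega>))"

definition initialization ::
    "(real^'a::finite^'s::finite \<Rightarrow> ereal) \<Rightarrow> 'w measure \<Rightarrow> ('w, 's, 'a) run \<Rightarrow> bool" where
  "initialization \<phi> M X \<longleftrightarrow>
     (\<exists>\<pi>0 \<in> effective_dom (psi_fun \<phi>). \<forall>\<omega>\<in>space M. pol X 0 \<omega> = \<pi>0) \<and>
     integrable M (\<lambda>\<omega>. norm (val X 0 \<omega>) ^ 4) \<and>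
     integrable M (\<lambda>\<omega>. norm (mult X 0 \<omega>) ^ 4)"

definition admm_run ::
    "('s::finite, 'a::finite) mdp \<Rightarrow> (real^'a^'s \<Rightarrow> ereal) \<Rightarrow> real^'s \<Rightarrow> real \<Rightarrow> real \<Rightarrow> real \<Rightarrow>
     ('s \<Rightarrow> 'a \<Rightarrow> 's \<Rightarrow> real) \<Rightarrow> ('s \<Rightarrow> 'a \<Rightarrow> real) \<Rightarrow> real \<Rightarrow> real \<Rightarrow> real \<Rightarrow>
     'w measure \<Rightarrow> (nat \<Rightarrow> nat) \<Rightarrow> ('w, 's, 'a) run \<Rightarrow> bool" where
  "admm_run D \<phi> c \<beta> \<eta>\<^sub>\<pi> \<eta>\<^sub>V P0 r0 \<kappa> \<alpha> M4 M m X \<longleftrightarrow>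
     prob_space M \<and> (\<forall>k. 1 \<le> m k) \<and>
     history_fields M m X \<and> adapted_run m X \<and>
     reset_chain D M m X \<and> noise_moments D M4 M m X \<and>
     admm_iteration D \<phi> c \<beta> \<eta>\<^sub>\<pi> \<eta>\<^sub>V P0 r0 M m X \<and> initialization \<phi> M X \<and>
     (\<forall>k s a. \<forall>\<omega>\<in>space M. \<alpha> \<le> behav X k \<omega> $ s $ a) \<and>
     (\<forall>k. \<forall>\<omega>\<in>space M. \<forall>\<pi>\<in>policies.
        spectral_norm (matrix_inv (M_pol (discount D) (P_hat P0 m X k \<omega>) \<pi>)) \<le> \<kappa>)"

section \<open>The dual increment bound\<close>

text \<open>\<open>increment x j\<close> is \<open>x j - x (j - 1)\<close>, used for \<open>j \<ge> 1\<close> only.\<close>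

definition increment :: "(nat \<Rightarrow> 'w \<Rightarrow> 'v::real_normed_vector) \<Rightarrow> nat \<Rightarrow> 'w \<Rightarrow> 'v" where
  "increment x j \<omega> = x j \<omega> - x (j - 1) \<omega>"

text \<open>Since the Bochner integral of a non-integrable function is \<open>0\<close>, the finiteness of the second moments
  has to be stated for the inequality to carry its usual meaning.\<close>

definition dual_increment_bound ::
    "'w measure \<Rightarrow> (nat \<Rightarrow> nat) \<Rightarrow> ('w, 's::finite, 'a::finite) run \<Rightarrow> real \<Rightarrow> real \<Rightarrow> real \<Rightarrow> nat \<Rightarrow> bool" where
  "dual_increment_bound M m X C\<^sub>\<pi> C\<^sub>V C\<^sub>\<epsilon> k \<longleftrightarrow>
     integrable M (\<lambda>\<omega>. (norm (increment (mult X) (k + 1) \<omega>))\<^sup>2) \<and>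
     integrable M (\<lambda>\<omega>. (norm (increment (pol X) (k + 1) \<omega>))\<^sup>2) \<and>
     integrable M (\<lambda>\<omega>. (norm (increment (val X) (k + 1) \<omega>))\<^sup>2) \<and>
     integrable M (\<lambda>\<omega>. (norm (increment (val X) k \<omega>))\<^sup>2) \<and>
     (\<integral>\<omega>. (norm (increment (mult X) (k + 1) \<omega>))\<^sup>2 \<partial>M)
       \<le> C\<^sub>\<pi> * (\<integral>\<omega>. (norm (increment (pol X) (k + 1) \<omega>))\<^sup>2 \<partial>M)
         + C\<^sub>V * (\<integral>\<omega>. (norm (increment (val X) (k + 1) \<omega>))\<^sup>2 \<partial>M)
         + C\<^sub>V * (\<integral>\<omega>. (norm (increment (val X) k \<omega>))\<^sup>2 \<partial>M)
         + C\<^sub>\<epsilon> * (1 / real (m k) + 1 / real (m (k - 1)))"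

end

theory Submission
  imports Defs
begin

text \<open>The policy of step \<open>k + 1\<close> is computed from batch \<open>k\<close>, so the
  model error at that policy is not centred given the past. The error is therefore controlled entry
  by entry in the transition rows, and from there uniformly over all policies. An empirical row is a
  ratio whose random denominator is correlated with its numerator; this forces the split by the
  number of visits. Second moments suffice: the event of few visits has probability
  \<open>O(1/m)\<close>, and an entry error is at most 1 there.

  The rate \<open>p\<close> comes from the resets, which reach every state whatever the environment
  does and wherever the batch starts. This makes the constants independent of the schedule and of
  the initial states.

  Rewards enter the residual, but the multiplier update absorbs the residual into the stationarity
  equation, so the error constant comes from the transition rows alone. The reward observations
  enter through the finiteness of the second moments of the iterates. The bound starts at
  \<open>k = 1\<close> because the old multiplier, too, must come from a value step; the initial one
  is arbitrary.\<close>

text \<open>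
  The stationarity of the value step gives \<open>\<lambda>\<^sub>k\<^sub>+\<^sub>1 = - N\<^sub>k\<^sup>T (c + \<Delta>V\<^sub>k\<^sub>+\<^sub>1 / \<eta>\<^sub>V)\<close>, where \<open>N\<^sub>k\<close> is the inverse of the
  empirical matrix at \<open>\<pi>\<^sub>k\<^sub>+\<^sub>1\<close>. Inserting the inverses of the true matrices at \<open>\<pi>\<^sub>k\<^sub>+\<^sub>1\<close> and \<open>\<pi>\<^sub>k\<close> splits
  \<open>\<Delta>\<lambda>\<^sub>k\<^sub>+\<^sub>1\<close> into five terms, which is the origin of the factor 5: two value increments, one policy
  increment and two model errors.

  The model error of a batch of \<open>m\<close> steps has second moment \<open>O(1/m)\<close> for every initial law. On the event
  that a pair is visited at least \<open>p m / 2\<close> times, the error is a martingale with bounded increments divided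
  by the number of visits. On the complement the error is at most 1, and there one of three further such
  martingales must be of order \<open>m\<close>. Every one of these martingales has second moment at most \<open>m\<close>.
\<close>

section \<open>Policy matrices and the value step\<close>

lemma prob_vectorD:
  assumes "prob_vector p"
  shows "0 \<le> p i" "p i \<le> 1" "(\<Sum>i\<in>UNIV. p i) = 1"
proof -
  show "0 \<le> p i" "(\<Sum>i\<in>UNIV. p i) = 1" using assms by (auto simp: prob_vector_def)
  have "p i \<le> (\<Sum>i\<in>UNIV. p i)" by (rule member_le_sum) (use assms in \<open>auto simp: prob_vector_def\<close>)
  then show "p i \<le> 1" using assms by (simp add: prob_vector_def)
qed

lemma spectral_norm_nonneg: "0 \<le> spectral_norm A"
  unfolding spectral_norm_def by (rule onorm_pos_le) simp

lemma norm_matrix_vector_le: "norm (A *v x) \<le> spectral_norm A * norm x"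
  unfolding spectral_norm_def by (rule onorm) simp

lemma spectral_norm_mult: "spectral_norm (A ** B) \<le> spectral_norm A * spectral_norm B"
proof -
  have "(\<lambda>x. (A ** B) *v x) = (\<lambda>x. A *v x) \<circ> (\<lambda>x. B *v x)"
    by (simp add: fun_eq_iff matrix_vector_mul_assoc)
  then show ?thesis unfolding spectral_norm_def by (simp add: onorm_compose)
qed

text \<open>The multiplier is a transposed inverse applied to a vector, while
  \<open>\<kappa>\<close> bounds the inverse itself. Pairing \<open>transpose A *v x\<close> with
  itself moves the transpose across the inner product and gives the one inequality between the two
  norms that is used.\<close>

lemma norm_transpose_mult_le: "norm (transpose A *v x) \<le> spectral_norm A * norm x"
proof -
  let ?y = "transpose A *v x"
  have "(norm ?y)\<^sup>2 = x \<bullet> (A *v ?y)"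
    by (metis dot_lmul_matrix power2_norm_eq_inner transpose_matrix_vector)
  also have "\<dots> \<le> norm x * norm (A *v ?y)" by (rule norm_cauchy_schwarz)
  also have "\<dots> \<le> norm x * (spectral_norm A * norm ?y)"
    by (intro mult_left_mono norm_matrix_vector_le) simp
  finally have "norm ?y * norm ?y \<le> (spectral_norm A * norm x) * norm ?y"
    by (simp add: power2_eq_square mult_ac)
  then show ?thesis
    by (cases "norm ?y = 0") (auto simp: spectral_norm_nonneg)
qed

lemma spectral_norm_minus_commute: "spectral_norm (A - B) = spectral_norm (B - A)"
  unfolding spectral_norm_def
  by (simp add: matrix_vector_mult_diff_rdistrib onorm_def norm_minus_commute)

section \<open>Policy matrices: stochasticity, invertibility and dependence on the model\<close>

lemma P_pol_stochastic:
  assumes "\<And>s a. prob_vector (Q s a)" and "\<pi> \<in> policies"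
  shows "prob_vector (\<lambda>s'. P_pol Q \<pi> $ s $ s')"
proof -
  have pi: "prob_vector (\<lambda>a. \<pi> $ s $ a)" using assms(2) by (simp add: policies_def)
  have "(\<Sum>s'\<in>UNIV. P_pol Q \<pi> $ s $ s') = (\<Sum>a\<in>UNIV. \<pi> $ s $ a * (\<Sum>s'\<in>UNIV. Q s a s'))"
    unfolding P_pol_def by (simp add: sum_distrib_left) (rule sum.swap)
  then have "(\<Sum>s'\<in>UNIV. P_pol Q \<pi> $ s $ s') = 1"
    using prob_vectorD(3)[OF assms(1)] prob_vectorD(3)[OF pi] by simp
  moreover have "0 \<le> P_pol Q \<pi> $ s $ s'" for s'
    unfolding P_pol_def using prob_vectorD(1)[OF assms(1)] prob_vectorD(1)[OF pi] by (simp add: sum_nonneg)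
  ultimately show ?thesis by (simp add: prob_vector_def)
qed

text \<open>A maximum principle: at a coordinate where a kernel vector has its largest modulus
  \<open>m\<close>, the equation \<open>x = \<gamma> P x\<close> gives
  \<open>m \<le> \<gamma> m\<close>, so the kernel is trivial. The argument uses only that the rows
  are stochastic, hence it covers the true model and every realization of the empirical one.\<close>

lemma M_pol_inverse:
  assumes "0 < \<gamma>" "\<gamma> < 1" and Q: "\<And>s a. prob_vector (Q s a)" and "\<pi> \<in> policies"
  shows "M_pol \<gamma> Q \<pi> ** matrix_inv (M_pol \<gamma> Q \<pi>) = mat 1"
    and "matrix_inv (M_pol \<gamma> Q \<pi>) ** M_pol \<gamma> Q \<pi> = mat 1"
proof -
  let ?P = "P_pol Q \<pi>"
  have st: "prob_vector (\<lambda>s'. ?P $ s $ s')" for s using P_pol_stochastic[OF Q assms(4)] .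
  have "x = 0" if x: "M_pol \<gamma> Q \<pi> *v x = 0" for x
  proof -
    define m where "m = Max (range (\<lambda>s. \<bar>x $ s\<bar>))"
    have le: "\<bar>x $ s\<bar> \<le> m" for s unfolding m_def by (rule Max_ge) auto
    have "m \<in> range (\<lambda>s. \<bar>x $ s\<bar>)" unfolding m_def by (rule Max_in) auto
    then obtain s0 where s0: "\<bar>x $ s0\<bar> = m" by auto
    have "0 = (x - \<gamma> *\<^sub>R (?P *v x)) $ s0"
      using x by (simp add: M_pol_def matrix_vector_mult_diff_rdistrib scaleR_matrix_vector_assoc)
    then have "x $ s0 = \<gamma> * (\<Sum>s'\<in>UNIV. ?P $ s0 $ s' * x $ s')"
      by (simp add: matrix_vector_mult_def)
    then have "m = \<gamma> * \<bar>\<Sum>s'\<in>UNIV. ?P $ s0 $ s' * x $ s'\<bar>"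
      using s0 assms(1) by (simp add: abs_mult)
    also have "\<dots> \<le> \<gamma> * (\<Sum>s'\<in>UNIV. ?P $ s0 $ s' * m)"
      using le prob_vectorD(1)[OF st] assms(1)
      by (intro mult_left_mono order.trans[OF sum_abs] sum_mono) (auto simp: abs_mult mult_left_mono)
    also have "\<dots> = \<gamma> * m"
      using prob_vectorD(3)[OF st] by (simp flip: sum_distrib_right)
    finally have "(1 - \<gamma>) * m \<le> 0" by (simp add: algebra_simps)
    then have "m \<le> 0" using assms(2) by (simp add: mult_le_0_iff)
    then have "x $ s = 0" for s using le[of s] by simp
    then show "x = 0" by (simp add: vec_eq_iff)
  qed
  then have "invertible (M_pol \<gamma> Q \<pi>)"
    by (auto simp: invertible_left_inverse matrix_left_invertible_ker)
  \<comment> \<open>\<open>matrix_inv\<close> is a choice operator, so both identities are read off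
    its defining property.\<close>
  then have "M_pol \<gamma> Q \<pi> ** matrix_inv (M_pol \<gamma> Q \<pi>) = mat 1
      \<and> matrix_inv (M_pol \<gamma> Q \<pi>) ** M_pol \<gamma> Q \<pi> = mat 1"
    unfolding invertible_def matrix_inv_def by (rule someI_ex)
  then show "M_pol \<gamma> Q \<pi> ** matrix_inv (M_pol \<gamma> Q \<pi>) = mat 1"
    and "matrix_inv (M_pol \<gamma> Q \<pi>) ** M_pol \<gamma> Q \<pi> = mat 1"
    by simp_all
qed

text \<open>A deterministic bound over all realizations. It is used to show that second moments of
  the iterates are finite, where a crude entrywise estimate is enough.\<close>

lemma spectral_norm_M_pol_le:
  fixes Q :: "'s::finite \<Rightarrow> 'a::finite \<Rightarrow> 's \<Rightarrow> real"
  assumes "0 < \<gamma>" "\<gamma> < 1" and Q: "\<And>s a. prob_vector (Q s a)" and "\<pi> \<in> policies"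
  shows "spectral_norm (M_pol \<gamma> Q \<pi>) \<le> 2 * real CARD('s) * real CARD('s)"
proof -
  have "\<bar>M_pol \<gamma> Q \<pi> $ i $ j\<bar> \<le> 2" for i j
  proof -
    have "prob_vector (\<lambda>j. P_pol Q \<pi> $ i $ j)" by (rule P_pol_stochastic[OF Q assms(4)])
    note p = prob_vectorD(1,2)[OF this, of j]
    have "\<gamma> * P_pol Q \<pi> $ i $ j \<le> 1" "0 \<le> \<gamma> * P_pol Q \<pi> $ i $ j"
      using mult_mono[of \<gamma> 1 "P_pol Q \<pi> $ i $ j" 1] p assms(1,2) by auto
    then show ?thesis by (auto simp: M_pol_def mat_def abs_le_iff)
  qed
  then show ?thesis
    unfolding spectral_norm_def using onorm_le_matrix_component by fastforce
qed

text \<open>A policy only averages the errors of the rows. The right-hand side is thus free of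
  \<open>\<pi>\<close>, which allows policies that depend on the batch.\<close>

lemma spectral_norm_M_pol_diff_le:
  fixes Q Q' :: "'s::finite \<Rightarrow> 'a::finite \<Rightarrow> 's \<Rightarrow> real"
  assumes "0 < \<gamma>" "\<gamma> < 1" and "\<pi> \<in> policies"
  shows "spectral_norm (M_pol \<gamma> Q \<pi> - M_pol \<gamma> Q' \<pi>)
    \<le> real CARD('s) * real CARD('s) * (\<Sum>(s, a, s')\<in>UNIV. \<bar>Q s a s' - Q' s a s'\<bar>)"
proof -
  let ?S = "\<Sum>(s, a, s')\<in>UNIV. \<bar>Q s a s' - Q' s a s'\<bar>"
  have "\<bar>(M_pol \<gamma> Q \<pi> - M_pol \<gamma> Q' \<pi>) $ i $ j\<bar> \<le> ?S" for i j
  proof -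
    have pi: "prob_vector (\<lambda>a. \<pi> $ i $ a)" using assms(3) by (simp add: policies_def)
    have "(M_pol \<gamma> Q \<pi> - M_pol \<gamma> Q' \<pi>) $ i $ j = \<gamma> * (\<Sum>a\<in>UNIV. \<pi> $ i $ a * (Q' i a j - Q i a j))"
      by (simp add: M_pol_def P_pol_def algebra_simps sum_subtractf)
    also have "\<bar>\<dots>\<bar> = \<gamma> * \<bar>\<Sum>a\<in>UNIV. \<pi> $ i $ a * (Q' i a j - Q i a j)\<bar>"
      using assms(1) by (simp add: abs_mult)
    also have "\<dots> \<le> 1 * (\<Sum>a\<in>UNIV. \<bar>Q i a j - Q' i a j\<bar>)"
    proof (intro mult_mono order.trans[OF sum_abs] sum_mono)
      fix a
      have "\<bar>\<pi> $ i $ a\<bar> * \<bar>Q' i a j - Q i a j\<bar> \<le> 1 * \<bar>Q' i a j - Q i a j\<bar>"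
        using prob_vectorD(1,2)[OF pi, of a] by (intro mult_right_mono) auto
      then show "\<bar>\<pi> $ i $ a * (Q' i a j - Q i a j)\<bar> \<le> \<bar>Q i a j - Q' i a j\<bar>"
        by (simp add: abs_mult abs_minus_commute)
    qed (use assms in auto)
    also have "\<dots> = (\<Sum>(s, a, s')\<in>(\<lambda>a. (i, a, j)) ` UNIV. \<bar>Q s a s' - Q' s a s'\<bar>)"
      by (subst sum.reindex) (auto simp: inj_on_def)
    also have "\<dots> \<le> ?S" by (rule sum_mono2) auto
    finally show ?thesis .
  qed
  then show ?thesis
    unfolding spectral_norm_def using onorm_le_matrix_component by fastforce
qed

text \<open>The resolvent identity: the difference of the inverses of \<open>A\<close> and
  \<open>B\<close> is the inverse of \<open>A\<close> times \<open>B - A\<close> times the inverse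
  of \<open>B\<close>. The two outer factors give \<open>\<kappa>\<close> squared, hence the fourth
  power of \<open>\<kappa>\<close> in the final coefficients.\<close>

lemma norm_inverse_transpose_diff_le:
  fixes A B :: "real^'n::finite^'n"
  assumes A: "matrix_inv A ** A = mat 1" "A ** matrix_inv A = mat 1" "spectral_norm (matrix_inv A) \<le> \<kappa>"
    and B: "matrix_inv B ** B = mat 1" "B ** matrix_inv B = mat 1" "spectral_norm (matrix_inv B) \<le> \<kappa>"
  shows "norm (transpose (matrix_inv A) *v c - transpose (matrix_inv B) *v c)
    \<le> \<kappa>\<^sup>2 * spectral_norm (A - B) * norm c"
proof -
  let ?A = "matrix_inv A" and ?B = "matrix_inv B"
  have k: "0 \<le> \<kappa>" using A(3) spectral_norm_nonneg[of ?A] by linarith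
  have "(?A - ?B) *v x = (?A ** (B - A) ** ?B) *v x" for x
  proof -
    have "?A *v (A *v y) = y" "B *v (?B *v y) = y" for y
      using A(1) B(2) by (simp_all add: matrix_vector_mul_assoc)
    then show ?thesis
      by (simp add: matrix_vector_mult_diff_rdistrib matrix_vector_mult_diff_distrib
          flip: matrix_vector_mul_assoc)
  qed
  then have eq: "?A - ?B = ?A ** (B - A) ** ?B" by (simp add: matrix_eq)
  have "spectral_norm (?A - ?B) \<le> spectral_norm (?A ** (B - A)) * spectral_norm ?B"
    unfolding eq by (rule spectral_norm_mult)
  also have "\<dots> \<le> (\<kappa> * spectral_norm (B - A)) * \<kappa>"
    using A(3) B(3) k
    by (intro mult_mono order.trans[OF spectral_norm_mult]) (auto simp: spectral_norm_nonneg)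
  finally have le: "spectral_norm (?A - ?B) \<le> \<kappa>\<^sup>2 * spectral_norm (A - B)"
    by (simp add: power2_eq_square mult_ac spectral_norm_minus_commute[of A])
  have "transpose ?A *v c - transpose ?B *v c = transpose (?A - ?B) *v c"
    by (simp add: transpose_def vec_eq_iff matrix_vector_mult_def left_diff_distrib sum_subtractf)
  then show ?thesis
    using norm_transpose_mult_le[of "?A - ?B" c] mult_right_mono[OF le norm_ge_zero[of c]] by simp
qed

lemma norm_r_pol_le:
  fixes q :: "'s::finite \<Rightarrow> 'a::finite \<Rightarrow> real"
  assumes "\<pi> \<in> policies"
  shows "norm (r_pol q \<pi>) \<le> (\<Sum>(s, a)\<in>UNIV. \<bar>q s a\<bar>)"
proof -
  have "norm (r_pol q \<pi>) \<le> (\<Sum>s\<in>UNIV. \<bar>r_pol q \<pi> $ s\<bar>)" by (rule norm_le_l1_cart)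
  also have "\<dots> \<le> (\<Sum>s\<in>UNIV. \<Sum>a\<in>UNIV. \<bar>q s a\<bar>)"
  proof (rule sum_mono)
    fix s
    have pi: "prob_vector (\<lambda>a. \<pi> $ s $ a)" using assms by (simp add: policies_def)
    have "\<bar>\<pi> $ s $ a * q s a\<bar> \<le> \<bar>q s a\<bar>" for a
      using mult_right_mono[OF prob_vectorD(2)[OF pi], of "\<bar>q s a\<bar>" a] prob_vectorD(1)[OF pi, of a]
      by (simp add: abs_mult)
    then show "\<bar>r_pol q \<pi> $ s\<bar> \<le> (\<Sum>a\<in>UNIV. \<bar>q s a\<bar>)"
      unfolding r_pol_def by (auto intro: order.trans[OF sum_abs] sum_mono)
  qed
  also have "\<dots> = (\<Sum>(s, a)\<in>UNIV. \<bar>q s a\<bar>)" by (simp add: sum.cartesian_product UNIV_Times_UNIV)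
  finally show ?thesis .
qed

section \<open>First-order condition and growth estimate for the value step\<close>

lemma linear_coefficient_zero:
  fixes a b :: real
  assumes "\<And>t. 0 \<le> t * a + t\<^sup>2 * b"
  shows "a = 0"
proof (rule ccontr)
  assume "a \<noteq> 0"
  \<comment> \<open>A step against the sign of \<open>a\<close>; the denominator keeps the quadratic
    term strictly below the linear one and stays positive when \<open>b = 0\<close>.\<close>
  define t where "t = - a / (1 + \<bar>b\<bar>)"
  have d: "0 < 1 + \<bar>b\<bar>" by simp
  have "t * a + t\<^sup>2 * b = (a\<^sup>2 / (1 + \<bar>b\<bar>)) * (b / (1 + \<bar>b\<bar>) - 1)"
    unfolding t_def by (simp only: power2_eq_square right_diff_distrib) simp
  moreover have "b / (1 + \<bar>b\<bar>) < 1" using d by (simp add: divide_less_eq)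
  moreover have "0 < a\<^sup>2 / (1 + \<bar>b\<bar>)" using \<open>a \<noteq> 0\<close> d by simp
  ultimately have "t * a + t\<^sup>2 * b < 0" by (metis diff_less_0_iff_less mult_pos_neg)
  then show False using assms[of t] by simp
qed

text \<open>The objective is quadratic, so along a line \<open>x + t h\<close> it expands exactly to
  second order in \<open>t\<close>. Minimality kills the linear coefficient in every direction
  \<open>h\<close>, without any differentiation.\<close>

lemma value_step_stationary:
  fixes A :: "real^'n::finite^'n"
  assumes min: "\<And>y. f x \<le> f y"
    and f: "\<And>y. f y = c \<bullet> y + l \<bullet> (A *v y - r) + \<beta> / 2 * (norm (A *v y - r))\<^sup>2
              + 1 / (2 * \<eta>) * (norm (y - x0))\<^sup>2"
  shows "c + transpose A *v (l + \<beta> *\<^sub>R (A *v x - r)) + (1 / \<eta>) *\<^sub>R (x - x0) = 0"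
proof -
  let ?u = "A *v x - r"
  let ?g = "c + transpose A *v (l + \<beta> *\<^sub>R ?u) + (1 / \<eta>) *\<^sub>R (x - x0)"
  have tr: "(transpose A *v y) \<bullet> h = y \<bullet> (A *v h)" for y h
    by (metis dot_lmul_matrix transpose_matrix_vector)
  have sq: "(norm (a + t *\<^sub>R b))\<^sup>2 = a \<bullet> a + 2 * t * (a \<bullet> b) + t\<^sup>2 * (b \<bullet> b)"
    for a b :: "real^'n" and t
    unfolding power2_norm_eq_inner
    by (simp add: inner_commute[of b a] power2_eq_square inner_add_left inner_add_right algebra_simps
        del: dot_square_norm)
  have "?g \<bullet> h = 0" for h
  proof (rule linear_coefficient_zero)
    fix t :: real
    let ?Q = "\<beta> / 2 * ((A *v h) \<bullet> (A *v h)) + 1 / (2 * \<eta>) * (h \<bullet> h)"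
    have 1: "A *v (x + t *\<^sub>R h) - r = ?u + t *\<^sub>R (A *v h)"
      by (simp add: matrix_vector_right_distrib matrix_vector_mult_scaleR)
    have 2: "x + t *\<^sub>R h - x0 = (x - x0) + t *\<^sub>R h" by simp
    have gh: "?g \<bullet> h = c \<bullet> h + l \<bullet> (A *v h) + \<beta> * (?u \<bullet> (A *v h)) + (1 / \<eta>) * ((x - x0) \<bullet> h)"
      by (simp only: inner_add_left tr inner_scaleR_left)
    have "f (x + t *\<^sub>R h) = f x + t * (?g \<bullet> h) + t\<^sup>2 * ?Q"
      unfolding f 1 2 sq gh power2_norm_eq_inner[of ?u] power2_norm_eq_inner[of "x - x0"]
        inner_add_right inner_scaleR_right
      by (simp only: add_divide_distrib distrib_left distrib_right) simp
    then show "0 \<le> t * (?g \<bullet> h) + t\<^sup>2 * ?Q"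
      using min[of "x + t *\<^sub>R h"] by linarith
  qed
  \<comment> \<open>The direction is taken to be the gradient itself.\<close>
  then have "?g \<bullet> ?g = 0" .
  then show ?thesis by (simp only: inner_eq_zero_iff)
qed

lemma value_step_norm_le:
  fixes A :: "real^'n::finite^'n"
  assumes stat: "c + transpose A *v (l + \<beta> *\<^sub>R (A *v x - r)) + (1 / \<eta>) *\<^sub>R (x - x0) = 0"
    and "0 < \<eta>" "0 < \<beta>" and K: "spectral_norm A \<le> K"
  shows "norm x \<le> norm x0 + \<eta> * (norm c + K * norm l + \<beta> * (K * norm r))"
proof -
  have tr: "x \<bullet> (transpose A *v y) = (A *v x) \<bullet> y" for y
    by (metis dot_lmul_matrix inner_commute transpose_matrix_vector)
  have trK: "norm (transpose A *v y) \<le> K * norm y" for y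
    using norm_transpose_mult_le[of A y] mult_right_mono[OF K norm_ge_zero[of y]] by simp
  let ?w = "(1 / \<eta>) *\<^sub>R x0 - c - transpose A *v l + \<beta> *\<^sub>R (transpose A *v r)"
  have w: "norm ?w \<le> norm x0 / \<eta> + norm c + K * norm l + \<beta> * (K * norm r)"
  proof -
    have "norm ?w \<le> norm ((1 / \<eta>) *\<^sub>R x0) + norm c + norm (transpose A *v l) + norm (\<beta> *\<^sub>R (transpose A *v r))"
      by (intro norm_triangle_mono norm_triangle_le_diff add_mono order.refl)
    also have "\<dots> \<le> norm x0 / \<eta> + norm c + K * norm l + \<beta> * (K * norm r)"
      using trK[of l] mult_left_mono[OF trK[of r], of \<beta>] assms(2,3)
      by (simp add: add_mono del: transpose_matrix_vector mult_le_cancel_left_pos)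
    finally show ?thesis .
  qed
  have "(1 / \<eta>) *\<^sub>R x + \<beta> *\<^sub>R (transpose A *v (A *v x)) = ?w"
    using stat by (simp add: matrix_vector_right_distrib matrix_vector_mult_diff_distrib
        matrix_vector_mult_scaleR algebra_simps)
  then have "x \<bullet> ((1 / \<eta>) *\<^sub>R x + \<beta> *\<^sub>R (transpose A *v (A *v x))) = x \<bullet> ?w" by simp
  then have "(1 / \<eta>) * (norm x)\<^sup>2 + \<beta> * (norm (A *v x))\<^sup>2 = x \<bullet> ?w"
    by (simp only: inner_add_right inner_scaleR_right tr power2_norm_eq_inner)
  moreover have "x \<bullet> ?w \<le> norm x * norm ?w" by (rule norm_cauchy_schwarz)
  moreover have "0 \<le> \<beta> * (norm (A *v x))\<^sup>2" using assms(3) by simp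
  ultimately have "(1 / \<eta>) * (norm x)\<^sup>2 \<le> norm x * norm ?w" by linarith
  then have "norm x * norm x \<le> norm x * (\<eta> * norm ?w)"
    using assms(2) by (simp add: field_simps power2_eq_square)
  then have "norm x \<le> \<eta> * norm ?w"
    using assms(2) by (cases "norm x = 0") (auto simp: mult_le_cancel_left)
  also have "\<dots> \<le> \<eta> * (norm x0 / \<eta> + norm c + K * norm l + \<beta> * (K * norm r))"
    using w assms(2) by (intro mult_left_mono) auto
  also have "\<dots> = norm x0 + \<eta> * (norm c + K * norm l + \<beta> * (K * norm r))"
    using assms(2) by (simp add: field_simps)
  finally show ?thesis .
qed

lemma norm_sum5_power2_le:
  fixes a b c d e :: "'v::real_normed_vector"
  shows "(norm (a + b + c + d + e))\<^sup>2 \<le> 5 * ((norm a)\<^sup>2 + (norm b)\<^sup>2 + (norm c)\<^sup>2 + (norm d)\<^sup>2 + (norm e)\<^sup>2)"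
proof -
  let ?f = "\<lambda>i::nat. norm ([a, b, c, d, e] ! i)"
  have "norm (a + b + c + d + e) \<le> (\<Sum>i<5. ?f i)"
    by (simp add: eval_nat_numeral) (meson norm_triangle_le add_mono order.refl order.trans norm_triangle_ineq add_right_mono)
  then have "(norm (a + b + c + d + e))\<^sup>2 \<le> (\<Sum>i<5. ?f i)\<^sup>2"
    by (rule power_mono) simp
  also have "\<dots> \<le> (\<Sum>i<5. (?f i)\<^sup>2) * real (card {..<5::nat})"
    by (rule sum_squared_le_sum_of_squares)
  finally show ?thesis by (simp add: eval_nat_numeral)
qed

section \<open>Sums of compensated indicators\<close>

text \<open>\<open>h\<close> agrees almost everywhere with the conditional probability of
  \<open>B\<close>, so a bounded test function known to \<open>F\<close> cannot detect the
  difference of the two. This yields the vanishing cross terms of the next lemma.\<close>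

lemma cond_prob_increment_orthogonal:
  assumes M: "prob_space M" and F: "subalgebra M F" and B: "B \<in> sets M"
    and cond: "AE \<omega> in M. real_cond_exp M F (indicator B) \<omega> = h \<omega>"
    and g: "g \<in> borel_measurable F" "\<And>\<omega>. \<omega> \<in> space M \<Longrightarrow> \<bar>g \<omega>\<bar> \<le> (K::real)"
    and h: "h \<in> borel_measurable M"
  shows "(\<integral>\<omega>. g \<omega> * (indicator B \<omega> - h \<omega>) \<partial>M) = 0"
proof -
  interpret prob_space M by (rule M)
  interpret finite_measure_subalgebra M F
    by (simp add: F finite_measure_subalgebra.intro finite_measure_axioms finite_measure_subalgebra_axioms.intro)
  have [measurable]: "g \<in> borel_measurable M" by (rule measurable_from_subalg[OF F g(1)])
  note [measurable] = B h
  have int: "integrable M (\<lambda>\<omega>. g \<omega> * indicator B \<omega>)"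
    by (rule integrable_const_bound[where B = K], intro AE_I2)
      (use g(2) in \<open>force simp: indicator_def intro: order.trans[OF abs_ge_zero]\<close>, simp)
  have m: "(indicator B :: _ \<Rightarrow> real) \<in> borel_measurable M" by simp
  have ae: "AE \<omega> in M. g \<omega> * real_cond_exp M F (indicator B) \<omega> = g \<omega> * h \<omega>" using cond by auto
  have eq: "(\<integral>\<omega>. g \<omega> * h \<omega> \<partial>M) = (\<integral>\<omega>. g \<omega> * indicator B \<omega> \<partial>M)"
    using real_cond_exp_intg(2)[OF int g(1) m] integral_cong_AE[OF _ _ ae] by simp
  have "integrable M (\<lambda>\<omega>. g \<omega> * h \<omega>)"
    using real_cond_exp_intg(1)[OF int g(1) m] integrable_cong_AE[OF _ _ ae] by simp
  then show ?thesis using eq int by (simp add: right_diff_distrib)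
qed

text \<open>Increments are orthogonal to the past and bounded by 1, so each step adds at most 1 to
  the second moment. The filtration property enters through \<open>adapted\<close>, so the same
  statement serves both interleaved families \<open>pre\<close> and \<open>post\<close>.\<close>

lemma martingale_sum_second_moment:
  fixes F :: "nat \<Rightarrow> 'w measure" and w h :: "nat \<Rightarrow> 'w \<Rightarrow> real" and B :: "nat \<Rightarrow> 'w set"
  defines "d \<equiv> \<lambda>t \<omega>. w t \<omega> * (indicator (B t) \<omega> - h t \<omega>)"
  assumes M: "prob_space M" and F: "\<And>t. t < n \<Longrightarrow> subalgebra M (F t)"
    and B: "\<And>t. t < n \<Longrightarrow> B t \<in> sets M"
    and cond: "\<And>t. t < n \<Longrightarrow> AE \<omega> in M. real_cond_exp M (F t) (indicator (B t)) \<omega> = h t \<omega>"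
    and w: "\<And>t. t < n \<Longrightarrow> w t \<in> borel_measurable (F t)"
      "\<And>t \<omega>. t < n \<Longrightarrow> \<omega> \<in> space M \<Longrightarrow> \<bar>w t \<omega>\<bar> \<le> 1"
    and h: "\<And>t. t < n \<Longrightarrow> h t \<in> borel_measurable M"
      "\<And>t \<omega>. t < n \<Longrightarrow> \<omega> \<in> space M \<Longrightarrow> 0 \<le> h t \<omega> \<and> h t \<omega> \<le> 1"
    and adapted: "\<And>t u. u < t \<Longrightarrow> t < n \<Longrightarrow> d u \<in> borel_measurable (F t)"
  shows "integrable M (\<lambda>\<omega>. (\<Sum>t<n. d t \<omega>)\<^sup>2)" and "(\<integral>\<omega>. (\<Sum>t<n. d t \<omega>)\<^sup>2 \<partial>M) \<le> real n"
proof -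
  interpret prob_space M by (rule M)
  have dm: "d t \<in> borel_measurable M" if "t < n" for t
    using measurable_from_subalg[OF F w(1)] B h(1) that unfolding d_def by (intro borel_measurable_times borel_measurable_diff) auto
  have d1: "\<bar>d t \<omega>\<bar> \<le> 1" if "t < n" "\<omega> \<in> space M" for t \<omega>
  proof -
    have "\<bar>indicator (B t) \<omega> - h t \<omega>\<bar> \<le> 1" using h(2)[OF that] by (auto simp: indicator_def)
    then have "\<bar>w t \<omega>\<bar> * \<bar>indicator (B t) \<omega> - h t \<omega>\<bar> \<le> 1 * 1"
      by (intro mult_mono) (use w(2)[OF that] in auto)
    then show ?thesis by (simp add: d_def abs_mult)
  qed
  have bnd: "\<bar>\<Sum>t<j. d t \<omega>\<bar> \<le> real j" if "j \<le> n" "\<omega> \<in> space M" for j \<omega>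
  proof -
    have "\<bar>\<Sum>t<j. d t \<omega>\<bar> \<le> (\<Sum>t<j. \<bar>d t \<omega>\<bar>)" by (rule sum_abs)
    also have "\<dots> \<le> (\<Sum>t<j. 1)" by (intro sum_mono d1) (use that in auto)
    finally show ?thesis by simp
  qed
  have intS: "integrable M (\<lambda>\<omega>. (\<Sum>t<j. d t \<omega>)\<^sup>2)" if "j \<le> n" for j
  proof (rule integrable_const_bound[where B = "(real j)\<^sup>2"])
    show "AE \<omega> in M. norm ((\<Sum>t<j. d t \<omega>)\<^sup>2) \<le> (real j)\<^sup>2"
      using bnd[OF that] by (intro AE_I2) (simp add: abs_le_square_iff[symmetric])
    show "(\<lambda>\<omega>. (\<Sum>t<j. d t \<omega>)\<^sup>2) \<in> borel_measurable M"
      using dm that by (intro borel_measurable_power borel_measurable_sum) auto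
  qed
  show "integrable M (\<lambda>\<omega>. (\<Sum>t<n. d t \<omega>)\<^sup>2)" by (rule intS) simp
  have "j \<le> n \<Longrightarrow> (\<integral>\<omega>. (\<Sum>t<j. d t \<omega>)\<^sup>2 \<partial>M) \<le> real j" for j
  proof (induction j)
    case (Suc j)
    let ?S = "\<lambda>\<omega>. \<Sum>t<j. d t \<omega>"
    have j: "j < n" using Suc.prems by simp
    have SF: "?S \<in> borel_measurable (F j)"
      using adapted j by (intro borel_measurable_sum) auto
    have bw: "\<bar>?S \<omega> * w j \<omega>\<bar> \<le> real j" if "\<omega> \<in> space M" for \<omega>
      using mult_mono[OF bnd[of j \<omega>] w(2)[OF j that]] that j by (simp add: abs_mult)
    \<comment> \<open>The weight joins the past sum in the test function, which leaves the bare
      compensated indicator as the increment.\<close>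
    have "(\<lambda>\<omega>. ?S \<omega> * w j \<omega>) \<in> borel_measurable (F j)"
      using SF w(1)[OF j] by simp
    from cond_prob_increment_orthogonal[OF M F[OF j] B[OF j] cond[OF j] this bw h(1)[OF j]]
    have z: "(\<integral>\<omega>. ?S \<omega> * d j \<omega> \<partial>M) = 0" by (simp add: d_def mult.assoc)
    have i1: "integrable M (\<lambda>\<omega>. ?S \<omega> * d j \<omega>)"
    proof (rule integrable_const_bound[where B = "real j"])
      show "AE \<omega> in M. norm (?S \<omega> * d j \<omega>) \<le> real j"
        using mult_mono[OF bnd[of j] d1[OF j]] j by (intro AE_I2) (simp add: abs_mult)
      show "(\<lambda>\<omega>. ?S \<omega> * d j \<omega>) \<in> borel_measurable M"
        using dm j by (intro borel_measurable_times borel_measurable_sum) auto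
    qed
    have d2: "(d j \<omega>)\<^sup>2 \<le> 1" if "\<omega> \<in> space M" for \<omega>
      using d1[OF j that] by (simp add: abs_square_le_1)
    have i2: "integrable M (\<lambda>\<omega>. (d j \<omega>)\<^sup>2)"
      by (rule integrable_const_bound[where B = 1]) (use d2 dm[OF j] in auto)
    have "(\<integral>\<omega>. (d j \<omega>)\<^sup>2 \<partial>M) \<le> 1"
      by (rule integral_le_const[OF i2]) (use d2 in auto)
    moreover have "(\<integral>\<omega>. (\<Sum>t<Suc j. d t \<omega>)\<^sup>2 \<partial>M)
      = (\<integral>\<omega>. (?S \<omega>)\<^sup>2 + 2 * (?S \<omega> * d j \<omega>) + (d j \<omega>)\<^sup>2 \<partial>M)"
      by (simp add: power2_sum algebra_simps)
    moreover have "\<dots> = (\<integral>\<omega>. (?S \<omega>)\<^sup>2 \<partial>M) + (\<integral>\<omega>. (d j \<omega>)\<^sup>2 \<partial>M)"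
      using i1 i2 intS[of j] j z by simp
    ultimately show ?case using Suc by simp
  qed simp
  then show "(\<integral>\<omega>. (\<Sum>t<n. d t \<omega>)\<^sup>2 \<partial>M) \<le> real n" by simp
qed

section \<open>The sampled chain\<close>

lemma subalgebra_trans:
  "subalgebra F G \<Longrightarrow> subalgebra G H \<Longrightarrow> subalgebra F H"
  by (auto simp: subalgebra_def)

lemma subalgebra_refl: "subalgebra F F"
  by (simp add: subalgebra_def)

lemma borel_measurable_finite3:
  fixes f :: "'i::finite \<Rightarrow> 'j::finite \<Rightarrow> 'l::finite \<Rightarrow> 'w \<Rightarrow> real"
  assumes "\<And>i j l. f i j l \<in> borel_measurable F"
    and "x \<in> measurable F (count_space UNIV)" "y \<in> measurable F (count_space UNIV)"
      "z \<in> measurable F (count_space UNIV)"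
  shows "(\<lambda>\<omega>. f (x \<omega>) (y \<omega>) (z \<omega>) \<omega>) \<in> borel_measurable F"
  by (rule measurable_compose_countable[OF measurable_compose_countable[OF measurable_compose_countable]])
    (use assms in auto)

lemma integrable_power2_dominated:
  fixes f g :: "'w \<Rightarrow> real"
  assumes "integrable M (\<lambda>\<omega>. (g \<omega>)\<^sup>2)" and "f \<in> borel_measurable M"
    and "\<And>\<omega>. \<omega> \<in> space M \<Longrightarrow> \<bar>f \<omega>\<bar> \<le> g \<omega>"
  shows "integrable M (\<lambda>\<omega>. (f \<omega>)\<^sup>2)"
  by (rule Bochner_Integration.integrable_bound[OF assms(1)])
    (use assms(2,3) in \<open>auto intro!: AE_I2 simp: abs_le_square_iff[symmetric] intro: order.trans[OF _ abs_ge_self]\<close>)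

lemma integrable_power2_add:
  fixes f g :: "'w \<Rightarrow> real"
  assumes [measurable]: "f \<in> borel_measurable M" "g \<in> borel_measurable M"
    and "integrable M (\<lambda>\<omega>. (f \<omega>)\<^sup>2)" "integrable M (\<lambda>\<omega>. (g \<omega>)\<^sup>2)"
  shows "integrable M (\<lambda>\<omega>. (f \<omega> + g \<omega>)\<^sup>2)"
proof (rule Bochner_Integration.integrable_bound)
  show "integrable M (\<lambda>\<omega>. 2 * (f \<omega>)\<^sup>2 + 2 * (g \<omega>)\<^sup>2)" using assms(3,4) by simp
  have "(f \<omega> + g \<omega>)\<^sup>2 \<le> 2 * (f \<omega>)\<^sup>2 + 2 * (g \<omega>)\<^sup>2" for \<omega>
    using sum_squares_bound[of "f \<omega>" "g \<omega>"] by (simp add: power2_sum)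
  then show "AE \<omega> in M. norm ((f \<omega> + g \<omega>)\<^sup>2) \<le> norm (2 * (f \<omega>)\<^sup>2 + 2 * (g \<omega>)\<^sup>2)"
    by (intro AE_I2) simp
qed simp

lemma integrable_power2_sum:
  fixes f :: "'i \<Rightarrow> 'w \<Rightarrow> real"
  assumes "finite I" "\<And>i. i \<in> I \<Longrightarrow> f i \<in> borel_measurable M" "\<And>i. i \<in> I \<Longrightarrow> integrable M (\<lambda>\<omega>. (f i \<omega>)\<^sup>2)"
  shows "integrable M (\<lambda>\<omega>. (\<Sum>i\<in>I. f i \<omega>)\<^sup>2)"
  using assms
proof (induction I rule: finite_induct)
  case (insert i I)
  have "integrable M (\<lambda>\<omega>. (f i \<omega> + (\<Sum>i\<in>I. f i \<omega>))\<^sup>2)"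
    by (rule integrable_power2_add) (use insert in \<open>auto intro!: borel_measurable_sum\<close>)
  then show ?case using insert by simp
qed simp

lemma integrable_power2_cmult:
  fixes f :: "'w \<Rightarrow> real"
  shows "integrable M (\<lambda>\<omega>. (f \<omega>)\<^sup>2) \<Longrightarrow> integrable M (\<lambda>\<omega>. (b * f \<omega>)\<^sup>2)"
  by (simp add: power_mult_distrib)

text \<open>The explicit coefficients may vanish, for instance when \<open>c = 0\<close>, while the
  claim also asks for positive ones. Enlarging them is harmless because the integrals are
  nonnegative.\<close>

lemma dual_increment_bound_mono:
  assumes "dual_increment_bound M m X C\<^sub>\<pi> C\<^sub>V C\<^sub>\<epsilon> k" "C\<^sub>\<pi> \<le> C\<^sub>\<pi>'" "C\<^sub>V \<le> C\<^sub>V'" "C\<^sub>\<epsilon> \<le> C\<^sub>\<epsilon>'"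
  shows "dual_increment_bound M m X C\<^sub>\<pi>' C\<^sub>V' C\<^sub>\<epsilon>' k"
proof -
  have "C\<^sub>\<pi> * (\<integral>\<omega>. (norm (increment (pol X) (k + 1) \<omega>))\<^sup>2 \<partial>M)
         + C\<^sub>V * (\<integral>\<omega>. (norm (increment (val X) (k + 1) \<omega>))\<^sup>2 \<partial>M)
         + C\<^sub>V * (\<integral>\<omega>. (norm (increment (val X) k \<omega>))\<^sup>2 \<partial>M)
         + C\<^sub>\<epsilon> * (1 / real (m k) + 1 / real (m (k - 1)))
    \<le> C\<^sub>\<pi>' * (\<integral>\<omega>. (norm (increment (pol X) (k + 1) \<omega>))\<^sup>2 \<partial>M)
         + C\<^sub>V' * (\<integral>\<omega>. (norm (increment (val X) (k + 1) \<omega>))\<^sup>2 \<partial>M)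
         + C\<^sub>V' * (\<integral>\<omega>. (norm (increment (val X) k \<omega>))\<^sup>2 \<partial>M)
         + C\<^sub>\<epsilon>' * (1 / real (m k) + 1 / real (m (k - 1)))"
    using assms(2-4) by (intro add_mono mult_right_mono) auto
  then show ?thesis using assms(1) unfolding dual_increment_bound_def by linarith
qed

text \<open>A single run is fixed here. Constants obtained inside must depend on the problem data
  alone; the final proof confirms this by restating them before any run is chosen.\<close>

locale sampled_admm = prob_space M
  for M :: "'w measure" +
  fixes D :: "('s::finite, 'a::finite) mdp" and \<phi> :: "real^'a^'s \<Rightarrow> ereal" and c :: "real^'s"
    and \<beta> \<eta>\<^sub>\<pi> \<eta>\<^sub>V \<kappa> \<rho>\<^sub>m\<^sub>i\<^sub>n \<alpha> M4 :: real
    and P0 :: "'s \<Rightarrow> 'a \<Rightarrow> 's \<Rightarrow> real" and r0 :: "'s \<Rightarrow> 'a \<Rightarrow> real"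
    and m :: "nat \<Rightarrow> nat" and X :: "('w, 's, 'a) run"
  assumes mdp: "is_mdp D"
    and phi: "proper_fun \<phi>" "effective_dom \<phi> \<inter> policies \<noteq> {}"
    and fallback: "\<And>s a. prob_vector (P0 s a)"
    and kappa: "\<And>\<pi>. \<pi> \<in> policies \<Longrightarrow>
      spectral_norm (matrix_inv (M_pol (discount D) (transition D) \<pi>)) \<le> \<kappa>"
    and coverage: "\<rho>\<^sub>m\<^sub>i\<^sub>n > 0" "\<alpha> > 0" "\<And>s. reset_dist D s \<ge> \<rho>\<^sub>m\<^sub>i\<^sub>n"
    and parameters: "\<beta> > 0" "\<eta>\<^sub>V > 0"
    and run: "admm_run D \<phi> c \<beta> \<eta>\<^sub>\<pi> \<eta>\<^sub>V P0 r0 \<kappa> \<alpha> M4 M m X"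
begin

abbreviation "\<gamma> \<equiv> discount D"

lemma discount: "0 < \<gamma>" "\<gamma> < 1"
  using mdp by (auto simp: is_mdp_def)

lemma transition_prob: "prob_vector (transition D s a)"
  using mdp by (auto simp: is_mdp_def)

lemma reset_dist_prob: "prob_vector (reset_dist D)"
  using mdp by (auto simp: is_mdp_def)

lemma m_pos: "0 < m k"
  using run by (auto simp: admm_run_def less_eq_Suc_le)

lemma behav_bounds:
  assumes "\<omega> \<in> space M"
  shows "\<alpha> \<le> behav X k \<omega> $ s $ a" "0 \<le> behav X k \<omega> $ s $ a" "behav X k \<omega> $ s $ a \<le> 1"
proof -
  show "\<alpha> \<le> behav X k \<omega> $ s $ a" using run assms by (auto simp: admm_run_def)
  have "prob_vector (\<lambda>a. behav X k \<omega> $ s $ a)"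
    using run assms by (auto simp: admm_run_def reset_chain_def policies_def)
  then show "0 \<le> behav X k \<omega> $ s $ a" "behav X k \<omega> $ s $ a \<le> 1" using prob_vectorD by blast+
qed

section \<open>The interleaved sigma-fields of a run and measurability with respect to them\<close>

lemma subalgebra_chain:
  shows "subalgebra M (hist X k)" "subalgebra (pre X k 0) (hist X k)"
    "subalgebra (hist X (Suc k)) (pre X k (m k))"
    and subalgebra_post_pre: "t < m k \<Longrightarrow> subalgebra (post X k t) (pre X k t)"
    and "t < m k \<Longrightarrow> subalgebra (pre X k (Suc t)) (post X k t)"
  using run by (auto simp: admm_run_def history_fields_def)

lemma subalgebra_pre_mono:
  assumes "t \<le> u" "u \<le> m k"
  shows "subalgebra (pre X k u) (pre X k t)"
  using assms
proof (induction u rule: dec_induct)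
  case (step n)
  have "subalgebra (pre X k (Suc n)) (pre X k n)"
    using step by (intro subalgebra_trans[OF subalgebra_chain(5) subalgebra_post_pre]) auto
  then show ?case using step by (auto intro: subalgebra_trans)
qed (rule subalgebra_refl)

lemma subalgebra_pre: "t \<le> m k \<Longrightarrow> subalgebra M (pre X k t)"
  using subalgebra_trans[OF subalgebra_trans[OF subalgebra_chain(1,3)] subalgebra_pre_mono] by blast

lemma subalgebra_pre_post: "t < u \<Longrightarrow> u \<le> m k \<Longrightarrow> subalgebra (pre X k u) (post X k t)"
  using subalgebra_trans[OF subalgebra_pre_mono[of "Suc t" u k] subalgebra_chain(5)] by simp

lemma subalgebra_post: "t < m k \<Longrightarrow> subalgebra M (post X k t)"
  using subalgebra_pre_post[of t "m k" k] subalgebra_pre[of "m k" k] by (auto intro: subalgebra_trans)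

lemma subalgebra_pre_hist: "t \<le> m k \<Longrightarrow> subalgebra (pre X k t) (hist X k)"
  using subalgebra_trans[OF subalgebra_pre_mono[of 0 t k] subalgebra_chain(2)] by simp

lemma state_measurable: "t \<le> m k \<Longrightarrow> state X k t \<in> measurable (pre X k t) (count_space UNIV)"
  and action_measurable: "t < m k \<Longrightarrow> action X k t \<in> measurable (post X k t) (count_space UNIV)"
  and reset_measurable: "t < m k \<Longrightarrow> reset X k t \<in> measurable (post X k t) (count_space UNIV)"
  and obs_measurable: "t < m k \<Longrightarrow> obs X k t \<in> borel_measurable (pre X k (Suc t))"
  using run by (auto simp: admm_run_def adapted_run_def)

lemma state_measurable_post: "t < m k \<Longrightarrow> state X k t \<in> measurable (post X k t) (count_space UNIV)"
  using state_measurable[of t k] subalgebra_post_pre[of t k] by (auto intro: measurable_from_subalg)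

lemma behav_measurable: "t \<le> m k \<Longrightarrow> (\<lambda>\<omega>. behav X k \<omega> $ s $ a) \<in> borel_measurable (pre X k t)"
proof -
  assume "t \<le> m k"
  have [measurable]: "behav X k \<in> borel_measurable (hist X k)"
    using run by (auto simp: admm_run_def adapted_run_def)
  have "(\<lambda>\<omega>. behav X k \<omega> $ s $ a) \<in> borel_measurable (hist X k)"
    by (intro borel_measurable_continuous_on[where f = "\<lambda>x. x $ s $ a"] continuous_intros) simp
  then show ?thesis using \<open>t \<le> m k\<close> subalgebra_pre_hist measurable_from_subalg by blast
qed

lemma borel_measurable_step:
  fixes f :: "'s \<Rightarrow> 'a \<Rightarrow> bool \<Rightarrow> real"
  assumes "t < m k"
  shows "(\<lambda>\<omega>. f (state X k t \<omega>) (action X k t \<omega>) (reset X k t \<omega>)) \<in> borel_measurable (post X k t)"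
  by (rule borel_measurable_finite3[where f = "\<lambda>i j l _. f i j l"])
    (use assms in \<open>auto intro: state_measurable_post action_measurable reset_measurable\<close>)

lemma borel_measurable_behav_state:
  assumes "t < m k"
  shows "(\<lambda>\<omega>. behav X k \<omega> $ state X k t \<omega> $ a) \<in> borel_measurable (pre X k t)"
  by (rule measurable_compose_countable[where f = "\<lambda>i \<omega>. behav X k \<omega> $ i $ a"])
    (use assms in \<open>auto intro: state_measurable behav_measurable\<close>)

lemma next_state_event:
  assumes "t < m k"
  shows "{\<omega> \<in> space M. state X k (Suc t) \<omega> = s} \<in> sets (pre X k (Suc t))"
proof -
  have "state X k (Suc t) -` {s} \<inter> space (pre X k (Suc t)) \<in> sets (pre X k (Suc t))"
    by (rule measurable_sets[OF state_measurable]) (use assms in auto)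
  moreover have "space (pre X k (Suc t)) = space M"
    using subalgebra_pre[of "Suc t" k] assms by (simp add: subalgebra_def)
  ultimately show ?thesis by (simp add: vimage_def Int_def conj_commute)
qed

lemma action_reset_event:
  assumes "t < m k"
  shows "{\<omega> \<in> space M. action X k t \<omega> = a \<and> reset X k t \<omega> = u} \<in> sets (post X k t)"
proof -
  have "(action X k t -` {a} \<inter> space (post X k t)) \<inter> (reset X k t -` {u} \<inter> space (post X k t))
      \<in> sets (post X k t)"
    by (intro sets.Int measurable_sets[OF action_measurable] measurable_sets[OF reset_measurable])
      (use assms in auto)
  moreover have "space (post X k t) = space M"
    using subalgebra_post[OF assms] by (simp add: subalgebra_def)
  moreover have "{\<omega> \<in> space M. action X k t \<omega> = a \<and> reset X k t \<omega> = u}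
    = (action X k t -` {a} \<inter> space M) \<inter> (reset X k t -` {u} \<inter> space M)" by auto
  ultimately show ?thesis by simp
qed

text \<open>A martingale difference for the family \<open>post\<close>: weight and compensator are
  known once state, action and coin are, and the next state is still to be drawn.\<close>

definition next_dev :: "('s \<Rightarrow> 'a \<Rightarrow> bool \<Rightarrow> real) \<Rightarrow> nat \<Rightarrow> 's \<Rightarrow> nat \<Rightarrow> 'w \<Rightarrow> real" where
  "next_dev w k s' t \<omega> = w (state X k t \<omega>) (action X k t \<omega>) (reset X k t \<omega>) *
     (indicator {\<omega>' \<in> space M. state X k (Suc t) \<omega>' = s'} \<omega> -
      (if reset X k t \<omega> then reset_dist D s' else transition D (state X k t \<omega>) (action X k t \<omega>) s'))"

text \<open>The counterpart for the family \<open>pre\<close>, drawn one stage earlier. Action and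
  coin form one event because their law is given jointly.\<close>

definition action_dev :: "('s \<Rightarrow> real) \<Rightarrow> nat \<Rightarrow> 'a \<Rightarrow> bool \<Rightarrow> nat \<Rightarrow> 'w \<Rightarrow> real" where
  "action_dev w k a u t \<omega> = w (state X k t \<omega>) *
     (indicator {\<omega>' \<in> space M. action X k t \<omega>' = a \<and> reset X k t \<omega>' = u} \<omega> -
      behav X k \<omega> $ state X k t \<omega> $ a * (if u then 1 - \<gamma> else \<gamma>))"

lemma next_dev_sum:
  assumes w: "\<And>s a u. \<bar>w s a u\<bar> \<le> 1"
  shows "integrable M (\<lambda>\<omega>. (\<Sum>t<m k. next_dev w k s' t \<omega>)\<^sup>2)"
    and "(\<integral>\<omega>. (\<Sum>t<m k. next_dev w k s' t \<omega>)\<^sup>2 \<partial>M) \<le> real (m k)"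
proof -
  let ?w = "\<lambda>t \<omega>. w (state X k t \<omega>) (action X k t \<omega>) (reset X k t \<omega>)"
  let ?B = "\<lambda>t. {\<omega>' \<in> space M. state X k (Suc t) \<omega>' = s'}"
  let ?h = "\<lambda>t \<omega>. if reset X k t \<omega> then reset_dist D s' else transition D (state X k t \<omega>) (action X k t \<omega>) s'"
  have w_meas: "?w t \<in> borel_measurable (post X k t)" if "t < m k" for t
    using borel_measurable_step[OF that, of w] .
  have h_meas: "?h t \<in> borel_measurable (post X k t)" if "t < m k" for t
    using borel_measurable_step[OF that, of "\<lambda>s a u. if u then reset_dist D s' else transition D s a s'"] .
  \<comment> \<open>The increment of step \<open>u\<close> involves the state at
    \<open>Suc u\<close>. It is known in \<open>pre X k (Suc u)\<close>, which is contained in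
    \<open>post X k t\<close> since \<open>u < t\<close>.\<close>
  have d_meas: "(\<lambda>\<omega>. ?w u \<omega> * (indicator (?B u) \<omega> - ?h u \<omega>)) \<in> borel_measurable (post X k t)"
    if "u < t" "t < m k" for u t
  proof -
    have "(\<lambda>\<omega>. ?w u \<omega> * (indicator (?B u) \<omega> - ?h u \<omega>)) \<in> borel_measurable (pre X k (Suc u))"
      by (intro borel_measurable_times borel_measurable_diff borel_measurable_indicator next_state_event
          measurable_from_subalg[OF subalgebra_pre_post w_meas] measurable_from_subalg[OF subalgebra_pre_post h_meas])
        (use that in auto)
    moreover have "subalgebra (post X k t) (pre X k (Suc u))"
      using subalgebra_trans[OF subalgebra_post_pre subalgebra_pre_mono] that by simp
    ultimately show ?thesis by (rule measurable_from_subalg[rotated])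
  qed
  have cond: "AE \<omega> in M. real_cond_exp M (post X k t) (indicator (?B t)) \<omega> = ?h t \<omega>" if "t < m k" for t
    using run that by (simp add: admm_run_def reset_chain_def)
  have B: "?B t \<in> sets M" if "t < m k" for t
    using next_state_event[OF that] subalgebra_pre[of "Suc t" k] that by (auto simp: subalgebra_def)
  have h01: "0 \<le> ?h t \<omega> \<and> ?h t \<omega> \<le> 1" for t \<omega>
    using prob_vectorD(1,2)[OF reset_dist_prob] prob_vectorD(1,2)[OF transition_prob] by auto
  note mart = martingale_sum_second_moment[where F = "post X k" and w = ?w and h = ?h and B = ?B and n = "m k",
      OF prob_space_axioms subalgebra_post B cond w_meas w _ h01 d_meas]
  show "integrable M (\<lambda>\<omega>. (\<Sum>t<m k. next_dev w k s' t \<omega>)\<^sup>2)"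
    and "(\<integral>\<omega>. (\<Sum>t<m k. next_dev w k s' t \<omega>)\<^sup>2 \<partial>M) \<le> real (m k)"
    unfolding next_dev_def
    using measurable_from_subalg[OF subalgebra_post h_meas] by (intro mart; assumption?; simp)+
qed

lemma action_dev_sum:
  assumes w: "\<And>s. \<bar>w s\<bar> \<le> 1"
  shows "integrable M (\<lambda>\<omega>. (\<Sum>t<m k. action_dev w k a u t \<omega>)\<^sup>2)"
    and "(\<integral>\<omega>. (\<Sum>t<m k. action_dev w k a u t \<omega>)\<^sup>2 \<partial>M) \<le> real (m k)"
proof -
  let ?w = "\<lambda>t \<omega>. w (state X k t \<omega>)"
  let ?B = "\<lambda>t. {\<omega>' \<in> space M. action X k t \<omega>' = a \<and> reset X k t \<omega>' = u}"
  let ?q = "if u then 1 - \<gamma> else \<gamma>"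
  let ?h = "\<lambda>t \<omega>. behav X k \<omega> $ state X k t \<omega> $ a * ?q"
  have w_meas: "?w t \<in> borel_measurable (pre X k t)" if "t < m k" for t
    by (rule measurable_compose[OF state_measurable]) (use that in auto)
  have h_meas: "?h t \<in> borel_measurable (pre X k t)" if "t < m k" for t
    using borel_measurable_behav_state[OF that, of a] by (intro borel_measurable_times) auto
  have d_meas: "(\<lambda>\<omega>. ?w v \<omega> * (indicator (?B v) \<omega> - ?h v \<omega>)) \<in> borel_measurable (pre X k t)"
    if "v < t" "t < m k" for v t
  proof -
    have "(\<lambda>\<omega>. ?w v \<omega> * (indicator (?B v) \<omega> - ?h v \<omega>)) \<in> borel_measurable (post X k v)"
      by (intro borel_measurable_times[OF measurable_from_subalg[OF subalgebra_post_pre w_meas]]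
          borel_measurable_diff borel_measurable_indicator action_reset_event
          measurable_from_subalg[OF subalgebra_post_pre h_meas])
        (use that in auto)
    moreover have "subalgebra (pre X k t) (post X k v)"
      using subalgebra_pre_post that by simp
    ultimately show ?thesis by (rule measurable_from_subalg[rotated])
  qed
  have cond: "AE \<omega> in M. real_cond_exp M (pre X k t) (indicator (?B t)) \<omega> = ?h t \<omega>" if "t < m k" for t
    using run that by (simp add: admm_run_def reset_chain_def)
  have B: "?B t \<in> sets M" if "t < m k" for t
    using action_reset_event[OF that] subalgebra_post[OF that] by (auto simp: subalgebra_def)
  have h01: "0 \<le> ?h t \<omega> \<and> ?h t \<omega> \<le> 1" if "\<omega> \<in> space M" for t \<omega>
    using behav_bounds(2,3)[OF that, of k "state X k t \<omega>" a] discount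
    by (auto intro!: mult_nonneg_nonneg mult_le_one)
  have pre: "subalgebra M (pre X k t)" if "t < m k" for t
    using subalgebra_pre that by simp
  note mart = martingale_sum_second_moment[where F = "pre X k" and w = ?w and h = ?h and B = ?B and n = "m k",
      OF prob_space_axioms pre B cond w_meas w _ h01 d_meas]
  show "integrable M (\<lambda>\<omega>. (\<Sum>t<m k. action_dev w k a u t \<omega>)\<^sup>2)"
    and "(\<integral>\<omega>. (\<Sum>t<m k. action_dev w k a u t \<omega>)\<^sup>2 \<partial>M) \<le> real (m k)"
    unfolding action_dev_def
    using measurable_from_subalg[OF pre h_meas] by (intro mart; assumption?; simp)+
qed

section \<open>Second moment of the model error\<close>

text \<open>The next states partition the visits of a pair, and \<open>fallback\<close> covers an
  unvisited one. Holding for every realization, this gives invertibility of the empirical matrices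
  and the bound 1 for the error of an entry.\<close>

lemma P_hat_prob: "prob_vector (P_hat P0 m X k \<omega> s a)"
proof (cases "visits m X k \<omega> s a = {}")
  case True
  then show ?thesis using fallback by (simp add: P_hat_def prob_vector_def)
next
  case False
  let ?N = "visits m X k \<omega> s a"
  have fin: "finite ?N" by (simp add: visits_def)
  have "(\<Sum>s'\<in>UNIV. card {t \<in> ?N. state X k (Suc t) \<omega> = s'}) = card (\<Union>s'\<in>UNIV. {t \<in> ?N. state X k (Suc t) \<omega> = s'})"
    by (rule card_UN_disjoint[symmetric]) (use fin in auto)
  also have "(\<Union>s'\<in>UNIV. {t \<in> ?N. state X k (Suc t) \<omega> = s'}) = ?N" by auto
  finally have "(\<Sum>s'\<in>UNIV. real (card {t \<in> ?N. state X k (Suc t) \<omega> = s'})) = real (card ?N)"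
    by (simp flip: of_nat_sum)
  then show ?thesis
    using False fin by (simp add: P_hat_def prob_vector_def sum_divide_distrib[symmetric])
qed

text \<open>These bounds let the factors in front of the deviations in \<open>card_visits_ge\<close>
  be replaced by 1. For \<open>\<alpha>\<close> a sample point is needed, since it bounds the
  realized behavior policy.\<close>

lemma coverage_le_1: "\<alpha> \<le> 1" "\<rho>\<^sub>m\<^sub>i\<^sub>n \<le> 1"
proof -
  obtain \<omega> where "\<omega> \<in> space M" using not_empty by auto
  then show "\<alpha> \<le> 1" using behav_bounds(1,3) order.trans by blast
  show "\<rho>\<^sub>m\<^sub>i\<^sub>n \<le> 1" using coverage(3) prob_vectorD(2)[OF reset_dist_prob] order.trans by blast
qed

text \<open>Read from the right: a reset together with a prescribed action, the reset leading to a
  prescribed state, the prescribed action there, and no reset at that step.\<close>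

definition visit_rate :: real where
  "visit_rate = \<gamma> * \<alpha> * (\<rho>\<^sub>m\<^sub>i\<^sub>n * \<alpha> * (1 - \<gamma>))"

lemma visit_rate_pos: "0 < visit_rate"
  using discount coverage by (simp add: visit_rate_def)

lemma card_eq_sum_of_bool:
  fixes n :: nat
  shows "real (card {t. t < n \<and> Q t}) = (\<Sum>t<n. of_bool (Q t))"
proof -
  have "{t. t < n \<and> Q t} = {..<n} \<inter> {t. Q t}" by auto
  then show ?thesis by simp
qed

text \<open>Three compensated sums turn the number of visits into visits of the state, the latter into resets,
  and the resets into steps.\<close>

lemma card_visits_ge:
  assumes \<omega>: "\<omega> \<in> space M"
  shows "real (card (visits m X k \<omega> s a)) \<ge> visit_rate * real (m k) - 1
    - \<bar>\<Sum>t<m k. action_dev (\<lambda>i. of_bool (i = s)) k a False t \<omega>\<bar>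
    - \<bar>\<Sum>t<m k. next_dev (\<lambda>_ _ _. 1) k s t \<omega>\<bar>
    - \<bar>\<Sum>t<m k. action_dev (\<lambda>_. 1) k a True t \<omega>\<bar>"
proof -
  let ?n = "m k"
  let ?s = "\<lambda>t. of_bool (state X k t \<omega> = s) :: real"
  let ?A = "\<Sum>t<?n. action_dev (\<lambda>i. of_bool (i = s)) k a False t \<omega>"
  let ?B = "\<Sum>t<?n. next_dev (\<lambda>_ _ _. 1) k s t \<omega>"
  let ?Z = "\<Sum>t<?n. action_dev (\<lambda>_. 1) k a True t \<omega>"
  have N: "real (card (visits m X k \<omega> s a)) =
    (\<Sum>t<?n. of_bool (\<not> reset X k t \<omega> \<and> state X k t \<omega> = s \<and> action X k t \<omega> = a))"
    unfolding visits_def by (rule card_eq_sum_of_bool)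
  have bh: "\<alpha> \<le> behav X k \<omega> $ i $ a" for i using behav_bounds[OF \<omega>] by blast
  have 1: "of_bool (\<not> reset X k t \<omega> \<and> state X k t \<omega> = s \<and> action X k t \<omega> = a)
      \<ge> action_dev (\<lambda>i. of_bool (i = s)) k a False t \<omega> + \<gamma> * \<alpha> * ?s t" for t
    using mult_left_mono[OF bh, of \<gamma>] discount \<omega>
    by (auto simp: action_dev_def indicator_def algebra_simps)
  have visits: "real (card (visits m X k \<omega> s a)) \<ge> ?A + \<gamma> * \<alpha> * (\<Sum>t<?n. ?s t)"
    unfolding N sum_distrib_left sum.distrib[symmetric] by (intro sum_mono 1)
  \<comment> \<open>Moves into \<open>s\<close> without a reset are credited with probability 0,
    since the environment need not lead to \<open>s\<close> at all.\<close>
  have 2: "?s (Suc t) \<ge> next_dev (\<lambda>_ _ _. 1) k s t \<omega> + \<rho>\<^sub>m\<^sub>i\<^sub>n * of_bool (reset X k t \<omega>)" for t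
    using \<omega> coverage(3)[of s] prob_vectorD(1)[OF transition_prob]
    by (auto simp: next_dev_def indicator_def)
  \<comment> \<open>Next states occupy the times 1 to \<open>?n\<close>, visits the times 0 to
    \<open>?n - 1\<close>. The shift costs at most the final state, which is the \<open>- 1\<close>
    of the statement.\<close>
  have "(\<Sum>t<Suc ?n. ?s t) = ?s 0 + (\<Sum>t<?n. ?s (Suc t))" by (rule sum.lessThan_Suc_shift)
  then have "(\<Sum>t<?n. ?s t) \<ge> (\<Sum>t<?n. ?s (Suc t)) - 1" by (simp add: of_bool_def split: if_splits)
  moreover have "(\<Sum>t<?n. ?s (Suc t)) \<ge> ?B + \<rho>\<^sub>m\<^sub>i\<^sub>n * (\<Sum>t<?n. of_bool (reset X k t \<omega>))"
    unfolding sum_distrib_left sum.distrib[symmetric] by (intro sum_mono 2)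
  ultimately have states: "(\<Sum>t<?n. ?s t) \<ge> ?B - 1 + \<rho>\<^sub>m\<^sub>i\<^sub>n * (\<Sum>t<?n. of_bool (reset X k t \<omega>))"
    by linarith
  \<comment> \<open>Only resets accompanied by the action \<open>a\<close> are counted, which
    matches the joint law of action and coin and costs the second factor \<open>\<alpha>\<close> in
    \<open>visit_rate\<close>.\<close>
  have 3: "of_bool (reset X k t \<omega>) \<ge> action_dev (\<lambda>_. 1) k a True t \<omega> + \<alpha> * (1 - \<gamma>)" for t
  proof -
    have "\<alpha> * (1 - \<gamma>) \<le> behav X k \<omega> $ state X k t \<omega> $ a * (1 - \<gamma>)"
      using mult_right_mono[OF bh, of "1 - \<gamma>"] discount by simp
    moreover have "0 \<le> behav X k \<omega> $ state X k t \<omega> $ a * (1 - \<gamma>)"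
      using behav_bounds(2)[OF \<omega>] discount by simp
    ultimately show ?thesis using \<omega> by (auto simp: action_dev_def indicator_def)
  qed
  have "(\<Sum>t<?n. of_bool (reset X k t \<omega>)) \<ge> (\<Sum>t<?n. action_dev (\<lambda>_. 1) k a True t \<omega> + \<alpha> * (1 - \<gamma>))"
    by (intro sum_mono 3)
  then have resets: "(\<Sum>t<?n. of_bool (reset X k t \<omega>)) \<ge> ?Z + real ?n * (\<alpha> * (1 - \<gamma>))"
    by (simp add: sum.distrib)
  have ga: "0 \<le> \<gamma> * \<alpha>" "\<gamma> * \<alpha> \<le> 1" using discount coverage coverage_le_1 by (auto intro: mult_le_one)
  have rho: "0 \<le> \<rho>\<^sub>m\<^sub>i\<^sub>n" using coverage by simp
  have "?A + \<gamma> * \<alpha> * (?B - 1 + \<rho>\<^sub>m\<^sub>i\<^sub>n * (?Z + real ?n * (\<alpha> * (1 - \<gamma>)))) \<le> real (card (visits m X k \<omega> s a))"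
    using mult_left_mono[OF order.trans[OF add_left_mono[OF mult_left_mono[OF resets rho], of "?B - 1"] states] ga(1)] visits
    by linarith
  then have main: "?A + \<gamma> * \<alpha> * ?B - \<gamma> * \<alpha> + \<gamma> * \<alpha> * \<rho>\<^sub>m\<^sub>i\<^sub>n * ?Z + visit_rate * real ?n
      \<le> real (card (visits m X k \<omega> s a))"
    by (simp add: visit_rate_def algebra_simps)
  \<comment> \<open>The deviations have either sign and carry factors between 0 and 1, so each
    product is bounded below by minus the absolute value of the deviation.\<close>
  have small: "- \<bar>z\<bar> \<le> q * z" if "0 \<le> q" "q \<le> 1" for q z :: real
    using mult_right_mono[of q 1 "\<bar>z\<bar>"] that by (cases "0 \<le> z") (auto simp: mult_nonneg_nonneg intro: order.trans[of _ 0])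
  have "\<gamma> * \<alpha> * \<rho>\<^sub>m\<^sub>i\<^sub>n \<le> 1" using ga rho coverage_le_1 by (auto intro: mult_le_one)
  then show ?thesis
    using main small[of "\<gamma> * \<alpha>" ?B] small[of "\<gamma> * \<alpha> * \<rho>\<^sub>m\<^sub>i\<^sub>n" ?Z] ga rho by (simp add: abs_le_iff)
qed

text \<open>An integrable majorant is produced instead of a moment of the error itself. It is a
  quadratic polynomial in four compensated sums with known second moments, so the argument does not
  go through measurability of \<open>P_hat\<close>.\<close>

lemma transition_error_moment:
  "\<exists>G. integrable M G \<and> (\<integral>\<omega>. G \<omega> \<partial>M) \<le> 68 / visit_rate\<^sup>2 / real (m k) \<and>
    (\<forall>\<omega>\<in>space M. (P_hat P0 m X k \<omega> s a s' - transition D s a s')\<^sup>2 \<le> G \<omega>)"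
proof -
  let ?n = "real (m k)" and ?p = visit_rate
  define A where "A \<omega> = (\<Sum>t<m k. action_dev (\<lambda>i. of_bool (i = s)) k a False t \<omega>)" for \<omega>
  define B where "B \<omega> = (\<Sum>t<m k. next_dev (\<lambda>_ _ _. 1) k s t \<omega>)" for \<omega>
  define Z where "Z \<omega> = (\<Sum>t<m k. action_dev (\<lambda>_. 1) k a True t \<omega>)" for \<omega>
  define S where "S \<omega> = (\<Sum>t<m k. next_dev (\<lambda>i j u. of_bool (\<not> u \<and> i = s \<and> j = a)) k s' t \<omega>)" for \<omega>
  \<comment> \<open>The first term serves the case of many visits, where 4 is the squared inverse of
    the one half in the threshold. The second serves the case of few: 16 is this 4 times the
    Cauchy-Schwarz factor 4 for three deviations and the lost unit in
    \<open>card_visits_ge\<close>.\<close>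
  define G where "G \<omega> = 4 / (?p * ?n)\<^sup>2 * (S \<omega>)\<^sup>2 + 16 / (?p * ?n)\<^sup>2 * ((A \<omega>)\<^sup>2 + (B \<omega>)\<^sup>2 + (Z \<omega>)\<^sup>2 + 1)" for \<omega>
  have n: "1 \<le> ?n" using m_pos[of k] by simp
  then have pn: "0 < ?p * ?n" using visit_rate_pos by simp
  have int: "integrable M (\<lambda>\<omega>. (A \<omega>)\<^sup>2)" "integrable M (\<lambda>\<omega>. (B \<omega>)\<^sup>2)"
      "integrable M (\<lambda>\<omega>. (Z \<omega>)\<^sup>2)" "integrable M (\<lambda>\<omega>. (S \<omega>)\<^sup>2)"
    and le: "(\<integral>\<omega>. (A \<omega>)\<^sup>2 \<partial>M) \<le> ?n" "(\<integral>\<omega>. (B \<omega>)\<^sup>2 \<partial>M) \<le> ?n"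
      "(\<integral>\<omega>. (Z \<omega>)\<^sup>2 \<partial>M) \<le> ?n" "(\<integral>\<omega>. (S \<omega>)\<^sup>2 \<partial>M) \<le> ?n"
    unfolding A_def B_def Z_def S_def by (intro action_dev_sum next_dev_sum; simp)+
  have "integrable M G" unfolding G_def using int by simp
  moreover have "(\<integral>\<omega>. G \<omega> \<partial>M) \<le> 68 / ?p\<^sup>2 / ?n"
  proof -
    have "(\<integral>\<omega>. G \<omega> \<partial>M) = 4 / (?p * ?n)\<^sup>2 * (\<integral>\<omega>. (S \<omega>)\<^sup>2 \<partial>M)
        + 16 / (?p * ?n)\<^sup>2 * ((\<integral>\<omega>. (A \<omega>)\<^sup>2 \<partial>M) + (\<integral>\<omega>. (B \<omega>)\<^sup>2 \<partial>M) + (\<integral>\<omega>. (Z \<omega>)\<^sup>2 \<partial>M) + 1)"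
      unfolding G_def using int by (simp add: prob_space)
    \<comment> \<open>The constant 1 is absorbed by \<open>1 \<le> ?n\<close>, and
      \<open>68 = 4 + 16 * 4\<close>.\<close>
    also have "\<dots> \<le> 4 / (?p * ?n)\<^sup>2 * ?n + 16 / (?p * ?n)\<^sup>2 * (?n + ?n + ?n + ?n)"
      using le n by (intro add_mono mult_left_mono) auto
    also have "\<dots> = 68 / ?p\<^sup>2 / ?n" using n visit_rate_pos by (simp add: field_simps power2_eq_square)
    finally show ?thesis .
  qed
  moreover have "(P_hat P0 m X k \<omega> s a s' - transition D s a s')\<^sup>2 \<le> G \<omega>" if \<omega>: "\<omega> \<in> space M" for \<omega>
  proof (cases "real (card (visits m X k \<omega> s a)) < ?p * ?n / 2")
    case True
    have "\<bar>P_hat P0 m X k \<omega> s a s' - transition D s a s'\<bar> \<le> 1"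
      using prob_vectorD(1,2)[OF P_hat_prob, of k \<omega> s a s'] prob_vectorD(1,2)[OF transition_prob, of s a s'] by linarith
    then have "(P_hat P0 m X k \<omega> s a s' - transition D s a s')\<^sup>2 \<le> 1" by (simp add: abs_square_le_1)
    also have "1 \<le> 16 / (?p * ?n)\<^sup>2 * ((A \<omega>)\<^sup>2 + (B \<omega>)\<^sup>2 + (Z \<omega>)\<^sup>2 + 1)"
    proof -
      have "?p * ?n / 2 \<le> \<bar>A \<omega>\<bar> + \<bar>B \<omega>\<bar> + \<bar>Z \<omega>\<bar> + 1"
        using card_visits_ge[OF \<omega>, of k s a] True unfolding A_def B_def Z_def by linarith
      then have "(?p * ?n / 2)\<^sup>2 \<le> (\<bar>A \<omega>\<bar> + \<bar>B \<omega>\<bar> + \<bar>Z \<omega>\<bar> + 1)\<^sup>2"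
        using pn by (intro power_mono) auto
      also have "\<dots> = (\<Sum>i<4. [\<bar>A \<omega>\<bar>, \<bar>B \<omega>\<bar>, \<bar>Z \<omega>\<bar>, 1] ! i)\<^sup>2" by (simp add: eval_nat_numeral)
      also have "\<dots> \<le> (\<Sum>i<4. ([\<bar>A \<omega>\<bar>, \<bar>B \<omega>\<bar>, \<bar>Z \<omega>\<bar>, 1] ! i)\<^sup>2) * real (card {..<4::nat})"
        by (rule sum_squared_le_sum_of_squares)
      also have "\<dots> = 4 * ((A \<omega>)\<^sup>2 + (B \<omega>)\<^sup>2 + (Z \<omega>)\<^sup>2 + 1)" by (simp add: eval_nat_numeral)
      finally have "(?p * ?n)\<^sup>2 \<le> 16 * ((A \<omega>)\<^sup>2 + (B \<omega>)\<^sup>2 + (Z \<omega>)\<^sup>2 + 1)"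
        by (simp add: power_divide)
      then show ?thesis using zero_less_power[OF pn, of 2] by (simp add: le_divide_eq_1)
    qed
    also have "\<dots> \<le> G \<omega>" unfolding G_def by simp
    finally show ?thesis .
  next
    case False
    let ?N = "visits m X k \<omega> s a"
    have N: "?p * ?n / 2 \<le> real (card ?N)" using False by simp
    then have N0: "0 < real (card ?N)" using pn by linarith
    then have ne: "?N \<noteq> {}" by auto
    \<comment> \<open>The weight keeps the non-reset steps at \<open>(s, a)\<close>, where the
      compensator is constant. Hence \<open>S\<close> is the number of visits times the error of the
      entry.\<close>
    have "S \<omega> = (\<Sum>t<m k. of_bool (\<not> reset X k t \<omega> \<and> state X k t \<omega> = s \<and> action X k t \<omega> = a \<and> state X k (Suc t) \<omega> = s')
        - transition D s a s' * of_bool (\<not> reset X k t \<omega> \<and> state X k t \<omega> = s \<and> action X k t \<omega> = a))"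
      unfolding S_def by (rule sum.cong) (use \<omega> in \<open>auto simp: next_dev_def indicator_def\<close>)
    also have "\<dots> = real (card {t \<in> ?N. state X k (Suc t) \<omega> = s'}) - transition D s a s' * real (card ?N)"
      unfolding sum_subtractf sum_distrib_left[symmetric] card_eq_sum_of_bool[symmetric]
      by (simp add: visits_def conj_assoc)
    finally have "P_hat P0 m X k \<omega> s a s' - transition D s a s' = S \<omega> / real (card ?N)"
      using ne N0 by (simp add: P_hat_def field_simps)
    then have "(P_hat P0 m X k \<omega> s a s' - transition D s a s')\<^sup>2 = (S \<omega>)\<^sup>2 / (real (card ?N))\<^sup>2"
      by (simp add: power_divide)
    also have "\<dots> \<le> (S \<omega>)\<^sup>2 / (?p * ?n / 2)\<^sup>2"
      using N pn by (intro divide_left_mono power_mono mult_pos_pos zero_less_power) auto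
    also have "\<dots> = 4 / (?p * ?n)\<^sup>2 * (S \<omega>)\<^sup>2" by (simp add: power_divide)
    also have "\<dots> \<le> G \<omega>" unfolding G_def by simp
    finally show ?thesis .
  qed
  ultimately show ?thesis by blast
qed

text \<open>The first factor is the squared passage from entries to the operator norm. The number of
  triples occurs once from Cauchy-Schwarz and once from adding equal moment bounds.\<close>

definition model_error_const :: real where
  "model_error_const = (real CARD('s) * real CARD('s))\<^sup>2 * (real CARD('s \<times> 'a \<times> 's))\<^sup>2 * (68 / visit_rate\<^sup>2)"

text \<open>The quantifier over policies stands inside the majorant because the policy inserted
  later is a function of the same batch.\<close>

lemma model_error_moment:
  "\<exists>H. integrable M H \<and> (\<integral>\<omega>. H \<omega> \<partial>M) \<le> model_error_const / real (m k) \<and>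
    (\<forall>\<omega>\<in>space M. \<forall>\<pi>\<in>policies.
      (spectral_norm (M_pol \<gamma> (P_hat P0 m X k \<omega>) \<pi> - M_pol \<gamma> (transition D) \<pi>))\<^sup>2 \<le> H \<omega>)"
proof -
  let ?e = "\<lambda>\<omega> (s, a, s'). P_hat P0 m X k \<omega> s a s' - transition D s a s'"
  let ?C = "real CARD('s) * real CARD('s)" and ?n = "real CARD('s \<times> 'a \<times> 's)"
  define Q where "Q z G \<longleftrightarrow> integrable M G \<and> (\<integral>\<omega>. G \<omega> \<partial>M) \<le> 68 / visit_rate\<^sup>2 / real (m k) \<and>
      (\<forall>\<omega>\<in>space M. (?e \<omega> z)\<^sup>2 \<le> G \<omega>)" for z and G :: "'w \<Rightarrow> real"
  have "\<exists>G. Q z G" for z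
    unfolding Q_def using transition_error_moment by (cases z) auto
  \<comment> \<open>One majorant is chosen for each triple; \<open>Q\<close> packages its three
    properties for this choice.\<close>
  then obtain G where "\<And>z. Q z (G z)" by metis
  then have G: "\<And>z. integrable M (G z)"
      "\<And>z. (\<integral>\<omega>. G z \<omega> \<partial>M) \<le> 68 / visit_rate\<^sup>2 / real (m k)"
      "\<And>z \<omega>. \<omega> \<in> space M \<Longrightarrow> (?e \<omega> z)\<^sup>2 \<le> G z \<omega>"
    unfolding Q_def by blast+
  define H where "H \<omega> = ?C\<^sup>2 * ?n * (\<Sum>z\<in>UNIV. G z \<omega>)" for \<omega>
  have "integrable M H" unfolding H_def using G(1) by simp
  moreover have "(\<integral>\<omega>. H \<omega> \<partial>M) \<le> model_error_const / real (m k)"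
  proof -
    have "(\<integral>\<omega>. H \<omega> \<partial>M) = ?C\<^sup>2 * ?n * (\<Sum>z\<in>UNIV. \<integral>\<omega>. G z \<omega> \<partial>M)"
      unfolding H_def using G(1) by simp
    also have "\<dots> \<le> ?C\<^sup>2 * ?n * (\<Sum>z\<in>(UNIV :: ('s \<times> 'a \<times> 's) set). 68 / visit_rate\<^sup>2 / real (m k))"
      using G(2) by (intro mult_left_mono sum_mono) auto
    also have "\<dots> = model_error_const / real (m k)"
      by (simp add: model_error_const_def power2_eq_square)
    finally show ?thesis .
  qed
  moreover have "(spectral_norm (M_pol \<gamma> (P_hat P0 m X k \<omega>) \<pi> - M_pol \<gamma> (transition D) \<pi>))\<^sup>2 \<le> H \<omega>"
    if "\<omega> \<in> space M" "\<pi> \<in> policies" for \<omega> \<pi>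
  proof -
    have "(\<Sum>(s, a, s')\<in>UNIV. \<bar>P_hat P0 m X k \<omega> s a s' - transition D s a s'\<bar>) = (\<Sum>z\<in>UNIV. \<bar>?e \<omega> z\<bar>)"
      by (rule sum.cong) auto
    then have "spectral_norm (M_pol \<gamma> (P_hat P0 m X k \<omega>) \<pi> - M_pol \<gamma> (transition D) \<pi>) \<le> ?C * (\<Sum>z\<in>UNIV. \<bar>?e \<omega> z\<bar>)"
      using spectral_norm_M_pol_diff_le[OF discount that(2), of "P_hat P0 m X k \<omega>" "transition D"] by simp
    then have "(spectral_norm (M_pol \<gamma> (P_hat P0 m X k \<omega>) \<pi> - M_pol \<gamma> (transition D) \<pi>))\<^sup>2 \<le> ?C\<^sup>2 * (\<Sum>z\<in>UNIV. \<bar>?e \<omega> z\<bar>)\<^sup>2"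
      unfolding power_mult_distrib[symmetric] by (rule power_mono) (rule spectral_norm_nonneg)
    also have "\<dots> \<le> ?C\<^sup>2 * ((\<Sum>z\<in>UNIV. \<bar>?e \<omega> z\<bar>\<^sup>2) * ?n)"
      by (intro mult_left_mono sum_squared_le_sum_of_squares) simp
    also have "\<dots> \<le> ?C\<^sup>2 * ((\<Sum>z\<in>UNIV. G z \<omega>) * ?n)"
      using G(3)[OF that(1)] by (intro mult_left_mono mult_right_mono sum_mono) auto
    also have "\<dots> = H \<omega>" by (simp add: H_def)
    finally show ?thesis .
  qed
  ultimately show ?thesis by blast
qed

section \<open>The dual increment\<close>

lemma M_hat_inverse:
  assumes "\<pi> \<in> policies"
  shows "M_pol \<gamma> (P_hat P0 m X k \<omega>) \<pi> ** matrix_inv (M_pol \<gamma> (P_hat P0 m X k \<omega>) \<pi>) = mat 1"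
    and "matrix_inv (M_pol \<gamma> (P_hat P0 m X k \<omega>) \<pi>) ** M_pol \<gamma> (P_hat P0 m X k \<omega>) \<pi> = mat 1"
  using M_pol_inverse[OF discount P_hat_prob assms] by auto

lemma M_hat_inverse_norm:
  "\<omega> \<in> space M \<Longrightarrow> \<pi> \<in> policies \<Longrightarrow>
    spectral_norm (matrix_inv (M_pol \<gamma> (P_hat P0 m X k \<omega>) \<pi>)) \<le> \<kappa>"
  using run by (auto simp: admm_run_def)

lemma admm_step:
  assumes "\<omega> \<in> space M"
  shows "is_arg_min (\<lambda>\<pi>. aug_lagrangian \<phi> c \<beta> \<gamma> (P_hat P0 m X k \<omega>) (r_hat r0 m X k \<omega>) \<pi> (val X k \<omega>) (mult X k \<omega>)
        + ereal (1 / (2 * \<eta>\<^sub>\<pi>) * (norm (\<pi> - pol X k \<omega>))\<^sup>2)) (\<lambda>\<pi>. \<pi> \<in> policies) (pol X (Suc k) \<omega>)"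
    and "is_arg_min (\<lambda>V. aug_lagrangian \<phi> c \<beta> \<gamma> (P_hat P0 m X k \<omega>) (r_hat r0 m X k \<omega>) (pol X (Suc k) \<omega>) V (mult X k \<omega>)
        + ereal (1 / (2 * \<eta>\<^sub>V) * (norm (V - val X k \<omega>))\<^sup>2)) (\<lambda>V. True) (val X (Suc k) \<omega>)"
    and "mult X (Suc k) \<omega> = mult X k \<omega> + \<beta> *\<^sub>R
        bellman_residual \<gamma> (P_hat P0 m X k \<omega>) (r_hat r0 m X k \<omega>) (pol X (Suc k) \<omega>) (val X (Suc k) \<omega>)"
  using run assms unfolding admm_run_def admm_iteration_def Let_def by blast+

lemma pol_in_policies: "\<omega> \<in> space M \<Longrightarrow> pol X (Suc k) \<omega> \<in> policies"
  using admm_step(1) by (auto simp: is_arg_min_def)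

text \<open>Comparison with a feasible point of finite cost. With an infinite value here the value
  subproblem would be identically infinite, every vector would minimize it, and no stationarity
  would follow.\<close>

lemma phi_pol_finite:
  assumes "\<omega> \<in> space M"
  shows "\<bar>\<phi> (pol X (Suc k) \<omega>)\<bar> \<noteq> \<infinity>"
proof -
  obtain \<pi> where \<pi>: "\<phi> \<pi> < \<infinity>" "\<pi> \<in> policies" using phi(2) by (auto simp: effective_dom_def)
  have "\<phi> (pol X (Suc k) \<omega>) \<noteq> \<infinity>"
    using admm_step(1)[OF assms, of k] \<pi> unfolding is_arg_min_def aug_lagrangian_def by force
  then show ?thesis using phi(1) by (auto simp: proper_fun_def)
qed

lemma value_stationary:
  fixes k :: nat
  assumes \<omega>: "\<omega> \<in> space M"
  defines "A \<equiv> M_pol \<gamma> (P_hat P0 m X k \<omega>) (pol X (Suc k) \<omega>)"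
    and "r \<equiv> r_pol (r_hat r0 m X k \<omega>) (pol X (Suc k) \<omega>)"
  shows "c + transpose A *v (mult X k \<omega> + \<beta> *\<^sub>R (A *v val X (Suc k) \<omega> - r))
    + (1 / \<eta>\<^sub>V) *\<^sub>R (val X (Suc k) \<omega> - val X k \<omega>) = 0"
proof (rule value_step_stationary)
  let ?f = "\<lambda>y. c \<bullet> y + mult X k \<omega> \<bullet> (A *v y - r) + \<beta> / 2 * (norm (A *v y - r))\<^sup>2
              + 1 / (2 * \<eta>\<^sub>V) * (norm (y - val X k \<omega>))\<^sup>2"
  obtain p where p: "\<phi> (pol X (Suc k) \<omega>) = ereal p"
    using phi_pol_finite[OF \<omega>, of k] by (cases "\<phi> (pol X (Suc k) \<omega>)") auto
  show "?f (val X (Suc k) \<omega>) \<le> ?f y" for y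
    using admm_step(2)[OF \<omega>, of k]
    unfolding is_arg_min_def aug_lagrangian_def bellman_residual_def p A_def[symmetric] r_def[symmetric]
    by (auto simp: not_less dest!: spec[of _ y])
qed simp

text \<open>The multiplier update is exactly the bracket in the stationarity equation. The residual,
  and with it the empirical rewards, therefore disappears, and inverting the transposed matrix
  solves for the new multiplier.\<close>

lemma mult_stationary:
  assumes \<omega>: "\<omega> \<in> space M"
  shows "mult X (Suc k) \<omega> = - (transpose (matrix_inv (M_pol \<gamma> (P_hat P0 m X k \<omega>) (pol X (Suc k) \<omega>)))
      *v (c + (1 / \<eta>\<^sub>V) *\<^sub>R (val X (Suc k) \<omega> - val X k \<omega>)))"
proof -
  let ?A = "M_pol \<gamma> (P_hat P0 m X k \<omega>) (pol X (Suc k) \<omega>)"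
  let ?w = "c + (1 / \<eta>\<^sub>V) *\<^sub>R (val X (Suc k) \<omega> - val X k \<omega>)"
  have "?w + transpose ?A *v mult X (Suc k) \<omega> = 0"
    using value_stationary[OF \<omega>, of k]
    by (simp add: admm_step(3)[OF \<omega>] bellman_residual_def algebra_simps)
  then have st: "transpose ?A *v mult X (Suc k) \<omega> = - ?w"
    by (simp only: add_eq_0_iff)
  have "mult X (Suc k) \<omega> = transpose (?A ** matrix_inv ?A) *v mult X (Suc k) \<omega>"
    using M_hat_inverse(1)[OF pol_in_policies[OF \<omega>]] by (simp del: transpose_matrix_vector)
  also have "\<dots> = transpose (matrix_inv ?A) *v (transpose ?A *v mult X (Suc k) \<omega>)"
    by (simp add: matrix_transpose_mul matrix_vector_mul_assoc del: transpose_matrix_vector)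
  also have "\<dots> = - (transpose (matrix_inv ?A) *v ?w)"
    unfolding st using matrix_vector_mult_diff_distrib[of "transpose (matrix_inv ?A)" 0 ?w] by simp
  finally show ?thesis .
qed

text \<open>Everything random is frozen at one sample point; \<open>H\<close> and \<open>H'\<close>
  are then numbers valid for all policies, to be evaluated at the two iterates. With
  \<open>1 \<le> k\<close> the formula of \<open>mult_stationary\<close> applies to both
  multipliers.\<close>

lemma dual_increment_pointwise:
  assumes \<omega>: "\<omega> \<in> space M" and k: "1 \<le> k"
    and Lipschitz: "\<And>\<pi> \<pi>'. \<pi> \<in> policies \<Longrightarrow> \<pi>' \<in> policies \<Longrightarrow>
      spectral_norm (M_pol \<gamma> (transition D) \<pi>' - M_pol \<gamma> (transition D) \<pi>) \<le> L * norm (\<pi>' - \<pi>)"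
    and H: "\<And>\<pi>. \<pi> \<in> policies \<Longrightarrow>
      (spectral_norm (M_pol \<gamma> (P_hat P0 m X k \<omega>) \<pi> - M_pol \<gamma> (transition D) \<pi>))\<^sup>2 \<le> H"
    and H': "\<And>\<pi>. \<pi> \<in> policies \<Longrightarrow>
      (spectral_norm (M_pol \<gamma> (P_hat P0 m X (k - 1) \<omega>) \<pi> - M_pol \<gamma> (transition D) \<pi>))\<^sup>2 \<le> H'"
  shows "(norm (increment (mult X) (k + 1) \<omega>))\<^sup>2 \<le>
      5 * \<kappa> ^ 4 * L\<^sup>2 * (norm c)\<^sup>2 * (norm (increment (pol X) (k + 1) \<omega>))\<^sup>2
    + 5 * \<kappa>\<^sup>2 / \<eta>\<^sub>V\<^sup>2 * (norm (increment (val X) (k + 1) \<omega>))\<^sup>2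
    + 5 * \<kappa>\<^sup>2 / \<eta>\<^sub>V\<^sup>2 * (norm (increment (val X) k \<omega>))\<^sup>2
    + 5 * \<kappa> ^ 4 * (norm c)\<^sup>2 * (H + H')"
proof -
  obtain j where j: "k = Suc j" using k by (cases k) auto
  define p where "p = pol X (Suc k) \<omega>"
  define p' where "p' = pol X k \<omega>"
  define v where "v = increment (val X) (k + 1) \<omega>"
  define v' where "v' = increment (val X) k \<omega>"
  let ?A = "M_pol \<gamma> (P_hat P0 m X k \<omega>) p" and ?A' = "M_pol \<gamma> (P_hat P0 m X j \<omega>) p'"
  let ?B = "M_pol \<gamma> (transition D) p" and ?B' = "M_pol \<gamma> (transition D) p'"
  let ?T = "\<lambda>A x. transpose (matrix_inv A) *v x"
  have pp: "p \<in> policies" "p' \<in> policies"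
    unfolding p_def p'_def j by (rule pol_in_policies[OF \<omega>])+
  have T_add: "?T A (x + y) = ?T A x + ?T A y" "?T A (b *\<^sub>R x) = b *\<^sub>R ?T A x" for A :: "real^'s^'s" and x y b
    by (simp_all add: matrix_vector_right_distrib matrix_vector_mult_scaleR del: transpose_matrix_vector)
  have "mult X (Suc k) \<omega> = - (?T ?A (c + (1 / \<eta>\<^sub>V) *\<^sub>R v))"
    using mult_stationary[OF \<omega>, of k] by (simp add: p_def v_def increment_def del: transpose_matrix_vector)
  moreover have "mult X k \<omega> = - (?T ?A' (c + (1 / \<eta>\<^sub>V) *\<^sub>R v'))"
    using mult_stationary[OF \<omega>, of j] by (simp add: p'_def v'_def j increment_def del: transpose_matrix_vector)
  \<comment> \<open>Each model error is taken at the policy computed with its own batch. The change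
    of policy is thus measured between true matrices, to which the Lipschitz assumption
    refers.\<close>
  ultimately have "increment (mult X) (k + 1) \<omega> =
      (?T ?B c - ?T ?A c) + (?T ?B' c - ?T ?B c) + (?T ?A' c - ?T ?B' c)
      + (- (1 / \<eta>\<^sub>V)) *\<^sub>R ?T ?A v + (1 / \<eta>\<^sub>V) *\<^sub>R ?T ?A' v'"
    unfolding increment_def by (simp add: T_add del: transpose_matrix_vector)
  then have "(norm (increment (mult X) (k + 1) \<omega>))\<^sup>2 \<le> 5 * ((norm (?T ?B c - ?T ?A c))\<^sup>2
      + (norm (?T ?B' c - ?T ?B c))\<^sup>2 + (norm (?T ?A' c - ?T ?B' c))\<^sup>2
      + (norm ((- (1 / \<eta>\<^sub>V)) *\<^sub>R ?T ?A v))\<^sup>2 + (norm ((1 / \<eta>\<^sub>V) *\<^sub>R ?T ?A' v'))\<^sup>2)"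
    by (simp only: norm_sum5_power2_le)
  also have "\<dots> \<le> 5 * (\<kappa> ^ 4 * (norm c)\<^sup>2 * H + \<kappa> ^ 4 * (norm c)\<^sup>2 * (L\<^sup>2 * (norm (p - p'))\<^sup>2)
      + \<kappa> ^ 4 * (norm c)\<^sup>2 * H' + \<kappa>\<^sup>2 / \<eta>\<^sub>V\<^sup>2 * (norm v)\<^sup>2 + \<kappa>\<^sup>2 / \<eta>\<^sub>V\<^sup>2 * (norm v')\<^sup>2)"
  proof (intro mult_left_mono add_mono)
    note invA = M_hat_inverse[OF pp(1), of k \<omega>] M_hat_inverse_norm[OF \<omega> pp(1), of k]
    note invA' = M_hat_inverse[OF pp(2), of j \<omega>] M_hat_inverse_norm[OF \<omega> pp(2), of j]
    note invB = M_pol_inverse[OF discount transition_prob pp(1)] kappa[OF pp(1)]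
    note invB' = M_pol_inverse[OF discount transition_prob pp(2)] kappa[OF pp(2)]
    have sq: "(norm (?T Y c - ?T Z c))\<^sup>2 \<le> \<kappa> ^ 4 * (norm c)\<^sup>2 * h"
      if "norm (?T Y c - ?T Z c) \<le> \<kappa>\<^sup>2 * spectral_norm (Y - Z) * norm c"
        and "(spectral_norm (Y - Z))\<^sup>2 \<le> h" for Y Z :: "real^'s^'s" and h
    proof -
      have "(norm (?T Y c - ?T Z c))\<^sup>2 \<le> (\<kappa>\<^sup>2 * spectral_norm (Y - Z) * norm c)\<^sup>2"
        using that(1) by (rule power_mono) simp
      also have "\<dots> = \<kappa> ^ 4 * (norm c)\<^sup>2 * (spectral_norm (Y - Z))\<^sup>2"
        by (simp add: power_mult_distrib flip: power_mult)
      also have "\<dots> \<le> \<kappa> ^ 4 * (norm c)\<^sup>2 * h" using that(2) by (intro mult_left_mono) auto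
      finally show ?thesis .
    qed
    show "(norm (?T ?B c - ?T ?A c))\<^sup>2 \<le> \<kappa> ^ 4 * (norm c)\<^sup>2 * H"
      by (rule sq[OF norm_inverse_transpose_diff_le])
        (use invA invB H[OF pp(1)] in \<open>simp_all add: spectral_norm_minus_commute[of ?B]\<close>)
    show "(norm (?T ?A' c - ?T ?B' c))\<^sup>2 \<le> \<kappa> ^ 4 * (norm c)\<^sup>2 * H'"
      by (rule sq[OF norm_inverse_transpose_diff_le]) (use invA' invB' H'[OF pp(2)] j in simp_all)
    have "(spectral_norm (?B' - ?B))\<^sup>2 \<le> (L * norm (p - p'))\<^sup>2"
      unfolding spectral_norm_minus_commute[of ?B']
      by (rule power_mono[OF Lipschitz[OF pp(2,1)] spectral_norm_nonneg])
    then have lip: "(spectral_norm (?B' - ?B))\<^sup>2 \<le> L\<^sup>2 * (norm (p - p'))\<^sup>2" by (simp add: power_mult_distrib)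
    show "(norm (?T ?B' c - ?T ?B c))\<^sup>2 \<le> \<kappa> ^ 4 * (norm c)\<^sup>2 * (L\<^sup>2 * (norm (p - p'))\<^sup>2)"
      by (rule sq[OF norm_inverse_transpose_diff_le lip]) (use invB invB' in simp_all)
    have sq': "(norm (b *\<^sub>R ?T Y x))\<^sup>2 \<le> \<kappa>\<^sup>2 / \<eta>\<^sub>V\<^sup>2 * (norm x)\<^sup>2"
      if "spectral_norm (matrix_inv Y) \<le> \<kappa>" "b\<^sup>2 = 1 / \<eta>\<^sub>V\<^sup>2" for Y :: "real^'s^'s" and x b
    proof -
      have "norm (?T Y x) \<le> \<kappa> * norm x"
        using norm_transpose_mult_le[of "matrix_inv Y" x] mult_right_mono[OF that(1) norm_ge_zero[of x]]
        by (rule order.trans)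
      then have "(norm (?T Y x))\<^sup>2 \<le> (\<kappa> * norm x)\<^sup>2" by (rule power_mono) simp
      then have "b\<^sup>2 * (norm (?T Y x))\<^sup>2 \<le> b\<^sup>2 * (\<kappa> * norm x)\<^sup>2" by (rule mult_left_mono) simp
      then show ?thesis
        using that(2) by (simp add: power_mult_distrib del: transpose_matrix_vector)
    qed
    show "(norm ((- (1 / \<eta>\<^sub>V)) *\<^sub>R ?T ?A v))\<^sup>2 \<le> \<kappa>\<^sup>2 / \<eta>\<^sub>V\<^sup>2 * (norm v)\<^sup>2"
      by (rule sq'[OF invA(3)]) (simp add: power_divide)
    show "(norm ((1 / \<eta>\<^sub>V) *\<^sub>R ?T ?A' v'))\<^sup>2 \<le> \<kappa>\<^sup>2 / \<eta>\<^sub>V\<^sup>2 * (norm v')\<^sup>2"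
      by (rule sq'[OF invA'(3)]) (simp add: power_divide)
  qed simp
  also have "\<dots> = 5 * \<kappa> ^ 4 * L\<^sup>2 * (norm c)\<^sup>2 * (norm (p - p'))\<^sup>2 + 5 * \<kappa>\<^sup>2 / \<eta>\<^sub>V\<^sup>2 * (norm v)\<^sup>2
      + 5 * \<kappa>\<^sup>2 / \<eta>\<^sub>V\<^sup>2 * (norm v')\<^sup>2 + 5 * \<kappa> ^ 4 * (norm c)\<^sup>2 * (H + H')"
    by (simp add: algebra_simps)
  finally show ?thesis by (simp add: p_def p'_def v_def v'_def increment_def)
qed

section \<open>Finite second moments of the observations, iterates and increments\<close>

lemma iterates_measurable:
  "pol X k \<in> borel_measurable M" "val X k \<in> borel_measurable M" "mult X k \<in> borel_measurable M"
  using run subalgebra_chain(1)[of k]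
  by (auto simp: admm_run_def adapted_run_def intro: measurable_from_subalg)

lemma obs_borel: "t < m k \<Longrightarrow> obs X k t \<in> borel_measurable M"
  using measurable_from_subalg[OF subalgebra_pre obs_measurable] by simp

text \<open>The conditional fourth moment bound is integrated over the whole space and lowered to a
  second moment by an elementary inequality that follows from a square being nonnegative.\<close>

lemma obs_square_integrable:
  assumes t: "t < m k"
  shows "integrable M (\<lambda>\<omega>. (obs X k t \<omega>)\<^sup>2)"
proof -
  let ?\<zeta> = "noise D X k t"
  let ?r = "\<lambda>\<omega>. reward D (state X k t \<omega>) (action X k t \<omega>)"
  have r: "?r \<in> borel_measurable M"
    using measurable_from_subalg[OF subalgebra_post[OF t] borel_measurable_step[OF t, of "\<lambda>s a _. reward D s a"]] .
  have \<zeta>: "?\<zeta> \<in> borel_measurable M"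
    unfolding noise_def using obs_borel[OF t] r by simp
  interpret F: finite_measure_subalgebra M "post X k t"
    by (simp add: subalgebra_post[OF t] finite_measure_subalgebra.intro finite_measure_axioms
        finite_measure_subalgebra_axioms.intro)
  have "(\<integral>\<^sup>+\<omega>. ennreal (\<bar>?\<zeta> \<omega>\<bar> ^ 4) \<partial>M) = (\<integral>\<^sup>+\<omega>. nn_cond_exp M (post X k t) (\<lambda>\<omega>. ennreal (\<bar>?\<zeta> \<omega>\<bar> ^ 4)) \<omega> \<partial>M)"
    using F.nn_cond_exp_intg[of "\<lambda>_. 1" "\<lambda>\<omega>. ennreal (\<bar>?\<zeta> \<omega>\<bar> ^ 4)"] \<zeta> by simp
  also have "\<dots> \<le> (\<integral>\<^sup>+\<omega>. ennreal M4 \<partial>M)"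
    using run t by (intro nn_integral_mono_AE) (simp add: admm_run_def noise_moments_def)
  also have "\<dots> < \<infinity>" by (simp add: emeasure_space_1)
  finally have i4: "integrable M (\<lambda>\<omega>. \<bar>?\<zeta> \<omega>\<bar> ^ 4)"
    using \<zeta> by (intro integrableI_nonneg) auto
  have i2: "integrable M (\<lambda>\<omega>. (?\<zeta> \<omega>)\<^sup>2)"
  proof (rule Bochner_Integration.integrable_bound)
    show "integrable M (\<lambda>\<omega>. 1 + \<bar>?\<zeta> \<omega>\<bar> ^ 4)" using i4 by simp
    have "x\<^sup>2 \<le> 1 + \<bar>x\<bar> ^ 4" for x :: real
    proof -
      have "0 \<le> (x\<^sup>2 - 1)\<^sup>2" by simp
      then have "2 * x\<^sup>2 \<le> 1 + (x\<^sup>2)\<^sup>2" by (simp add: power2_diff)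
      moreover have "(x\<^sup>2)\<^sup>2 = \<bar>x\<bar> ^ 4" by (simp flip: power_mult)
      moreover have "0 \<le> x\<^sup>2" by simp
      ultimately show ?thesis by linarith
    qed
    then show "AE \<omega> in M. norm ((?\<zeta> \<omega>)\<^sup>2) \<le> norm (1 + \<bar>?\<zeta> \<omega>\<bar> ^ 4)" by (intro AE_I2) simp
  qed (use \<zeta> in simp)
  define R where "R = Max (range (\<lambda>(s, a). \<bar>reward D s a\<bar>))"
  have "\<bar>reward D s a\<bar> \<le> R" for s a unfolding R_def by (rule Max_ge) force+
  then have "integrable M (\<lambda>\<omega>. (?r \<omega>)\<^sup>2)"
    by - (rule integrable_power2_dominated[where g = "\<lambda>_. R", OF _ r], auto)
  from integrable_power2_add[OF \<zeta> r i2 this] show ?thesis by (simp add: noise_def)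
qed

text \<open>An average is bounded by the full sum of absolute observations. This is wasteful in the
  batch size, but it removes the random set of visits, and the result is used for finiteness
  alone.\<close>

lemma r_hat_le:
  "\<bar>r_hat r0 m X k \<omega> s a\<bar> \<le> \<bar>r0 s a\<bar> + (\<Sum>t<m k. \<bar>obs X k t \<omega>\<bar>)"
proof (cases "visits m X k \<omega> s a = {}")
  case True
  then show ?thesis by (simp add: r_hat_def sum_nonneg)
next
  case False
  let ?N = "visits m X k \<omega> s a"
  have fin: "finite ?N" by (simp add: visits_def)
  then have "1 \<le> real (card ?N)" using False by (simp add: Suc_le_eq card_gt_0_iff)
  then have "\<bar>r_hat r0 m X k \<omega> s a\<bar> \<le> \<bar>\<Sum>t\<in>?N. obs X k t \<omega>\<bar>"
    using False mult_left_mono[of 1 "real (card ?N)" "\<bar>\<Sum>t\<in>?N. obs X k t \<omega>\<bar>"]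
    by (simp add: r_hat_def divide_le_eq)
  also have "\<dots> \<le> (\<Sum>t\<in>?N. \<bar>obs X k t \<omega>\<bar>)" by (rule sum_abs)
  also have "\<dots> \<le> (\<Sum>t<m k. \<bar>obs X k t \<omega>\<bar>)" by (rule sum_mono2) (auto simp: visits_def)
  finally show ?thesis by simp
qed

text \<open>A joint induction: the new value grows at most linearly in the old value, the old
  multiplier and the observations, and the new multiplier linearly in the old multiplier, the new
  value and the observations. The moments may grow with \<open>k\<close> and the batch sizes, since
  they enter no constant.\<close>

lemma iterates_square_integrable:
  "integrable M (\<lambda>\<omega>. (norm (val X k \<omega>))\<^sup>2) \<and> integrable M (\<lambda>\<omega>. (norm (mult X k \<omega>))\<^sup>2)"
proof (induction k)
  case 0
  have *: "integrable M (\<lambda>\<omega>. (f \<omega>)\<^sup>2)"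
    if i: "integrable M (\<lambda>\<omega>. f \<omega> ^ 4)" and [measurable]: "f \<in> borel_measurable M" for f :: "'w \<Rightarrow> real"
  proof -
    have "integrable M (\<lambda>\<omega>. ((f \<omega>)\<^sup>2)\<^sup>2)" using i by (simp flip: power_mult)
    then show ?thesis by (rule square_integrable_imp_integrable[rotated]) simp
  qed
  show ?case
    using run iterates_measurable(2,3)[of 0] by (auto simp: admm_run_def initialization_def intro!: *)
next
  case (Suc k)
  define K where "K = 2 * real CARD('s) * real CARD('s)"
  define n where "n = real CARD('s \<times> 'a)"
  define C where "C = (\<Sum>(s, a)\<in>UNIV. \<bar>r0 s a\<bar>)"
  define Y where "Y \<omega> = (\<Sum>t<m k. \<bar>obs X k t \<omega>\<bar>)" for \<omega>
  let ?V = "\<lambda>\<omega>. norm (val X k \<omega>)" and ?L = "\<lambda>\<omega>. norm (mult X k \<omega>)"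
  let ?V' = "\<lambda>\<omega>. norm (val X (Suc k) \<omega>)" and ?L' = "\<lambda>\<omega>. norm (mult X (Suc k) \<omega>)"
  have K0: "0 \<le> K" by (simp add: K_def)
  have Y: "Y \<in> borel_measurable M" "integrable M (\<lambda>\<omega>. (Y \<omega>)\<^sup>2)"
    unfolding Y_def using obs_borel obs_square_integrable
    by (auto intro!: integrable_power2_sum borel_measurable_sum)
  have meas [measurable]: "?V \<in> borel_measurable M" "?L \<in> borel_measurable M"
      "?V' \<in> borel_measurable M" "?L' \<in> borel_measurable M" "Y \<in> borel_measurable M"
    using iterates_measurable Y by auto
  have rh: "norm (r_pol (r_hat r0 m X k \<omega>) (pol X (Suc k) \<omega>)) \<le> C + n * Y \<omega>" if "\<omega> \<in> space M" for \<omega>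
  proof -
    have "norm (r_pol (r_hat r0 m X k \<omega>) (pol X (Suc k) \<omega>)) \<le> (\<Sum>(s, a)\<in>UNIV. \<bar>r_hat r0 m X k \<omega> s a\<bar>)"
      by (rule norm_r_pol_le[OF pol_in_policies[OF that]])
    also have "\<dots> \<le> (\<Sum>(s, a)\<in>UNIV. \<bar>r0 s a\<bar> + Y \<omega>)"
      using r_hat_le unfolding Y_def by (intro sum_mono) auto
    also have "\<dots> = C + n * Y \<omega>"
      unfolding C_def n_def by (simp add: case_prod_beta' sum.distrib)
    finally show ?thesis .
  qed
  have Mh: "spectral_norm (M_pol \<gamma> (P_hat P0 m X k \<omega>) (pol X (Suc k) \<omega>)) \<le> K" if "\<omega> \<in> space M" for \<omega>
    unfolding K_def by (rule spectral_norm_M_pol_le[OF discount P_hat_prob pol_in_policies[OF that]])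
  let ?G = "\<lambda>\<omega>. ?V \<omega> + \<eta>\<^sub>V * (norm c + K * ?L \<omega> + \<beta> * (K * (C + n * Y \<omega>)))"
  have "?V' \<omega> \<le> ?G \<omega>" if \<omega>: "\<omega> \<in> space M" for \<omega>
  proof -
    have "?V' \<omega> \<le> ?V \<omega> + \<eta>\<^sub>V * (norm c + K * ?L \<omega>
        + \<beta> * (K * norm (r_pol (r_hat r0 m X k \<omega>) (pol X (Suc k) \<omega>))))"
      by (rule value_step_norm_le[OF value_stationary[OF \<omega>] parameters(2,1) Mh[OF \<omega>]])
    also have "\<dots> \<le> ?G \<omega>"
      using rh[OF \<omega>] parameters K0 by (intro add_left_mono mult_left_mono) auto
    finally show ?thesis .
  qed
  moreover have "integrable M (\<lambda>\<omega>. (?G \<omega>)\<^sup>2)"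
    using Suc Y by (intro integrable_power2_add integrable_power2_cmult) auto
  ultimately have V': "integrable M (\<lambda>\<omega>. (?V' \<omega>)\<^sup>2)"
    by - (rule integrable_power2_dominated[where g = ?G], auto)
  let ?G' = "\<lambda>\<omega>. ?L \<omega> + \<beta> * (K * ?V' \<omega> + (C + n * Y \<omega>))"
  have "?L' \<omega> \<le> ?G' \<omega>" if \<omega>: "\<omega> \<in> space M" for \<omega>
  proof -
    let ?A = "M_pol \<gamma> (P_hat P0 m X k \<omega>) (pol X (Suc k) \<omega>)"
    have "?L' \<omega> \<le> ?L \<omega> + \<beta> * norm (?A *v val X (Suc k) \<omega> - r_pol (r_hat r0 m X k \<omega>) (pol X (Suc k) \<omega>))"
      using norm_triangle_ineq[of "mult X k \<omega>"] parameters(1)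
      by (simp add: admm_step(3)[OF \<omega>, of k] bellman_residual_def norm_triangle_le)
    also have "\<dots> \<le> ?G' \<omega>"
    proof (intro add_left_mono mult_left_mono order.trans[OF norm_triangle_ineq4] add_mono rh[OF \<omega>])
      show "norm (?A *v val X (Suc k) \<omega>) \<le> K * ?V' \<omega>"
        using norm_matrix_vector_le mult_right_mono[OF Mh[OF \<omega>] norm_ge_zero] by (rule order.trans)
    qed (use parameters in simp)
    finally show ?thesis .
  qed
  moreover have "integrable M (\<lambda>\<omega>. (?G' \<omega>)\<^sup>2)"
    using Suc V' Y by (intro integrable_power2_add integrable_power2_cmult) auto
  ultimately have "integrable M (\<lambda>\<omega>. (?L' \<omega>)\<^sup>2)"
    by - (rule integrable_power2_dominated[where g = ?G'], auto)
  with V' show ?case by simp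
qed

lemma norm_policy_le:
  fixes \<pi> :: "real^'a^'s"
  assumes "\<pi> \<in> policies"
  shows "norm \<pi> \<le> real CARD('s) * real CARD('a)"
proof -
  have "norm \<pi> \<le> (\<Sum>s\<in>UNIV. norm (\<pi> $ s))" unfolding norm_vec_def by (rule L2_set_le_sum) simp
  also have "\<dots> \<le> (\<Sum>s\<in>(UNIV :: 's set). real CARD('a))"
  proof (rule sum_mono)
    fix s
    have "prob_vector (\<lambda>a. \<pi> $ s $ a)" using assms by (simp add: policies_def)
    then have "(\<Sum>a\<in>UNIV. \<bar>\<pi> $ s $ a\<bar>) \<le> (\<Sum>a\<in>(UNIV :: 'a set). 1)"
      by (intro sum_mono) (simp add: prob_vectorD)
    then show "norm (\<pi> $ s) \<le> real CARD('a)" using norm_le_l1_cart[of "\<pi> $ s"] by simp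
  qed
  finally show ?thesis by simp
qed

lemma increments_square_integrable:
  assumes "1 \<le> k"
  shows "integrable M (\<lambda>\<omega>. (norm (increment (mult X) (k + 1) \<omega>))\<^sup>2)"
    and "integrable M (\<lambda>\<omega>. (norm (increment (pol X) (k + 1) \<omega>))\<^sup>2)"
    and "integrable M (\<lambda>\<omega>. (norm (increment (val X) (k + 1) \<omega>))\<^sup>2)"
    and "integrable M (\<lambda>\<omega>. (norm (increment (val X) k \<omega>))\<^sup>2)"
proof -
  have *: "integrable M (\<lambda>\<omega>. (norm (increment x j \<omega>))\<^sup>2)"
    if m: "\<And>i. x i \<in> borel_measurable M" and i: "\<And>i. integrable M (\<lambda>\<omega>. (norm (x i \<omega>))\<^sup>2)"
    for x :: "nat \<Rightarrow> 'w \<Rightarrow> real^'s" and j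
  proof (rule integrable_power2_dominated)
    note [measurable] = m
    show "integrable M (\<lambda>\<omega>. (norm (x j \<omega>) + norm (x (j - 1) \<omega>))\<^sup>2)"
      by (rule integrable_power2_add) (simp_all add: i)
    show "(\<lambda>\<omega>. norm (increment x j \<omega>)) \<in> borel_measurable M"
      unfolding increment_def by simp
  qed (simp add: increment_def norm_triangle_ineq4)
  show "integrable M (\<lambda>\<omega>. (norm (increment (mult X) (k + 1) \<omega>))\<^sup>2)"
    and "integrable M (\<lambda>\<omega>. (norm (increment (val X) (k + 1) \<omega>))\<^sup>2)"
    and "integrable M (\<lambda>\<omega>. (norm (increment (val X) k \<omega>))\<^sup>2)"
    using iterates_measurable iterates_square_integrable by (auto intro!: *)
  \<comment> \<open>With \<open>k \<ge> 1\<close> both policies of the increment are outcomes of a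
    policy step, hence bounded.\<close>
  obtain j where j: "k = Suc j" using assms by (cases k) auto
  let ?b = "real CARD('s) * real CARD('a)"
  show "integrable M (\<lambda>\<omega>. (norm (increment (pol X) (k + 1) \<omega>))\<^sup>2)"
  proof (rule integrable_power2_dominated[where g = "\<lambda>_. ?b + ?b"])
    note [measurable] = iterates_measurable(1)
    show "(\<lambda>\<omega>. norm (increment (pol X) (k + 1) \<omega>)) \<in> borel_measurable M"
      unfolding increment_def by simp
    fix \<omega> assume \<omega>: "\<omega> \<in> space M"
    have "norm (increment (pol X) (k + 1) \<omega>) \<le> norm (pol X (Suc k) \<omega>) + norm (pol X k \<omega>)"
      unfolding increment_def by (simp add: norm_triangle_ineq4)
    also have "\<dots> \<le> ?b + ?b"
      unfolding j by (intro add_mono norm_policy_le pol_in_policies \<omega>)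
    finally show "\<bar>norm (increment (pol X) (k + 1) \<omega>)\<bar> \<le> ?b + ?b" by simp
  qed simp
qed

lemma dual_increment:
  assumes k: "1 \<le> k"
    and Lipschitz: "\<And>\<pi> \<pi>'. \<pi> \<in> policies \<Longrightarrow> \<pi>' \<in> policies \<Longrightarrow>
      spectral_norm (M_pol \<gamma> (transition D) \<pi>' - M_pol \<gamma> (transition D) \<pi>) \<le> L * norm (\<pi>' - \<pi>)"
  shows "dual_increment_bound M m X (5 * \<kappa> ^ 4 * L\<^sup>2 * (norm c)\<^sup>2) (5 * \<kappa>\<^sup>2 / \<eta>\<^sub>V\<^sup>2)
    (5 * \<kappa> ^ 4 * (norm c)\<^sup>2 * model_error_const) k"
proof -
  obtain H where H: "integrable M H" "(\<integral>\<omega>. H \<omega> \<partial>M) \<le> model_error_const / real (m k)"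
      "\<And>\<omega> \<pi>. \<omega> \<in> space M \<Longrightarrow> \<pi> \<in> policies \<Longrightarrow>
        (spectral_norm (M_pol \<gamma> (P_hat P0 m X k \<omega>) \<pi> - M_pol \<gamma> (transition D) \<pi>))\<^sup>2 \<le> H \<omega>"
    using model_error_moment[of k] by blast
  obtain H' where H': "integrable M H'" "(\<integral>\<omega>. H' \<omega> \<partial>M) \<le> model_error_const / real (m (k - 1))"
      "\<And>\<omega> \<pi>. \<omega> \<in> space M \<Longrightarrow> \<pi> \<in> policies \<Longrightarrow>
        (spectral_norm (M_pol \<gamma> (P_hat P0 m X (k - 1) \<omega>) \<pi> - M_pol \<gamma> (transition D) \<pi>))\<^sup>2 \<le> H' \<omega>"
    using model_error_moment[of "k - 1"] by blast
  note int = increments_square_integrable[OF k]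
  let ?l = "\<lambda>\<omega>. (norm (increment (mult X) (k + 1) \<omega>))\<^sup>2" and ?p = "\<lambda>\<omega>. (norm (increment (pol X) (k + 1) \<omega>))\<^sup>2"
  let ?v = "\<lambda>\<omega>. (norm (increment (val X) (k + 1) \<omega>))\<^sup>2" and ?v' = "\<lambda>\<omega>. (norm (increment (val X) k \<omega>))\<^sup>2"
  let ?a = "5 * \<kappa> ^ 4 * L\<^sup>2 * (norm c)\<^sup>2" and ?b = "5 * \<kappa>\<^sup>2 / \<eta>\<^sub>V\<^sup>2" and ?e = "5 * \<kappa> ^ 4 * (norm c)\<^sup>2"
  have "(\<integral>\<omega>. ?l \<omega> \<partial>M) \<le> (\<integral>\<omega>. ?a * ?p \<omega> + ?b * ?v \<omega> + ?b * ?v' \<omega> + ?e * (H \<omega> + H' \<omega>) \<partial>M)"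
  proof (rule integral_mono)
    show "integrable M (\<lambda>\<omega>. ?a * ?p \<omega> + ?b * ?v \<omega> + ?b * ?v' \<omega> + ?e * (H \<omega> + H' \<omega>))"
      using int H(1) H'(1) by (intro Bochner_Integration.integrable_add integrable_mult_right) auto
    show "?l \<omega> \<le> ?a * ?p \<omega> + ?b * ?v \<omega> + ?b * ?v' \<omega> + ?e * (H \<omega> + H' \<omega>)" if "\<omega> \<in> space M" for \<omega>
      by (rule dual_increment_pointwise[OF that k Lipschitz H(3)[OF that] H'(3)[OF that]])
  qed (rule int(1))
  also have "\<dots> = ?a * (\<integral>\<omega>. ?p \<omega> \<partial>M) + ?b * (\<integral>\<omega>. ?v \<omega> \<partial>M) + ?b * (\<integral>\<omega>. ?v' \<omega> \<partial>M)
      + ?e * ((\<integral>\<omega>. H \<omega> \<partial>M) + (\<integral>\<omega>. H' \<omega> \<partial>M))"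
    using int H(1) H'(1) by simp
  also have "\<dots> \<le> ?a * (\<integral>\<omega>. ?p \<omega> \<partial>M) + ?b * (\<integral>\<omega>. ?v \<omega> \<partial>M) + ?b * (\<integral>\<omega>. ?v' \<omega> \<partial>M)
      + ?e * (model_error_const / real (m k) + model_error_const / real (m (k - 1)))"
    using H(2) H'(2) by (intro add_left_mono mult_left_mono add_mono) auto
  finally show ?thesis
    unfolding dual_increment_bound_def using int by (simp add: distrib_left)
qed

end

theorem lemma4p3:
  fixes D :: "('s::finite, 'a::finite) mdp"
    and \<phi> :: "real^'a^'s \<Rightarrow> ereal"
    and c :: "real^'s"
    and \<beta> \<eta>\<^sub>\<pi> \<eta>\<^sub>V \<tau> \<kappa> L\<^sub>M \<rho>\<^sub>m\<^sub>i\<^sub>n \<alpha> R\<^sub>m\<^sub>a\<^sub>x M4 :: real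
    and P0 :: "'s \<Rightarrow> 'a \<Rightarrow> 's \<Rightarrow> real"
    and r0 :: "'s \<Rightarrow> 'a \<Rightarrow> real"
  assumes mdp: "is_mdp D"
    and phi: "proper_fun \<phi>" "lsc_on policies \<phi>" "bounded_below_on policies \<phi>"
      "effective_dom \<phi> \<inter> policies \<noteq> {}"
    and fallback: "\<And>s a. prob_vector (P0 s a)"
    and kappa: "\<And>\<pi>. \<pi> \<in> policies \<Longrightarrow>
      spectral_norm (matrix_inv (M_pol (discount D) (transition D) \<pi>)) \<le> \<kappa>"
    and coverage: "\<rho>\<^sub>m\<^sub>i\<^sub>n > 0" "\<alpha> > 0" "\<And>s. reset_dist D s \<ge> \<rho>\<^sub>m\<^sub>i\<^sub>n"
      "\<And>s a. \<bar>reward D s a\<bar> \<le> R\<^sub>m\<^sub>a\<^sub>x"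
    and parameters: "\<beta> > 0" "\<eta>\<^sub>\<pi> > 0" "\<eta>\<^sub>V > 0" "\<tau> = 1 / (8 * \<eta>\<^sub>V)"
    and Lipschitz: "\<And>\<pi> \<pi>'. \<pi> \<in> policies \<Longrightarrow> \<pi>' \<in> policies \<Longrightarrow>
      spectral_norm (M_pol (discount D) (transition D) \<pi>' - M_pol (discount D) (transition D) \<pi>)
        \<le> L\<^sub>M * norm (\<pi>' - \<pi>)"
    and reduced: "bounded_below_on policies (reduced_objective D \<phi> c)"
    and margin: "\<beta> > max (60 * \<kappa>\<^sup>2 / \<eta>\<^sub>V) (30 * \<eta>\<^sub>\<pi> * \<kappa> ^ 4 * L\<^sub>M\<^sup>2 * (norm c)\<^sup>2)"
  shows
    "(\<exists>C\<^sub>\<pi>>0. \<exists>C\<^sub>V>0. \<exists>C\<^sub>\<epsilon>>0.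
        \<forall>(M :: 'w measure) m X. admm_run D \<phi> c \<beta> \<eta>\<^sub>\<pi> \<eta>\<^sub>V P0 r0 \<kappa> \<alpha> M4 M m X \<longrightarrow>
          (\<forall>k\<ge>1. dual_increment_bound M m X C\<^sub>\<pi> C\<^sub>V C\<^sub>\<epsilon> k)) \<and>
     (\<exists>C\<^sub>\<epsilon>>0.
        \<forall>(M :: 'w measure) m X. admm_run D \<phi> c \<beta> \<eta>\<^sub>\<pi> \<eta>\<^sub>V P0 r0 \<kappa> \<alpha> M4 M m X \<longrightarrow>
          (\<forall>k\<ge>1. dual_increment_bound M m X
             (5 * \<kappa> ^ 4 * L\<^sub>M\<^sup>2 * (norm c)\<^sup>2) (5 * \<kappa>\<^sup>2 / \<eta>\<^sub>V\<^sup>2) C\<^sub>\<epsilon> k))"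
proof -
  \<comment> \<open>\<open>p\<close> and \<open>e\<close> spell out \<open>visit_rate\<close> and
    \<open>model_error_const\<close> before any run is fixed. This makes the constants uniform in
    the probability space, the schedule and \<open>k\<close>.\<close>
  define p where "p = discount D * \<alpha> * (\<rho>\<^sub>m\<^sub>i\<^sub>n * \<alpha> * (1 - discount D))"
  let ?a = "5 * \<kappa> ^ 4 * L\<^sub>M\<^sup>2 * (norm c)\<^sup>2" and ?b = "5 * \<kappa>\<^sup>2 / \<eta>\<^sub>V\<^sup>2"
  define e where "e = 5 * \<kappa> ^ 4 * (norm c)\<^sup>2 *
    ((real CARD('s) * real CARD('s))\<^sup>2 * (real CARD('s \<times> 'a \<times> 's))\<^sup>2 * (68 / p\<^sup>2))"
  have bound: "dual_increment_bound M m X ?a ?b e k"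
    if "admm_run D \<phi> c \<beta> \<eta>\<^sub>\<pi> \<eta>\<^sub>V P0 r0 \<kappa> \<alpha> M4 M m X" "1 \<le> k"
    for M :: "'w measure" and m X k
  proof -
    interpret prob_space M using that(1) by (simp add: admm_run_def)
    interpret sampled_admm M D \<phi> c \<beta> \<eta>\<^sub>\<pi> \<eta>\<^sub>V \<kappa> \<rho>\<^sub>m\<^sub>i\<^sub>n \<alpha> M4 P0 r0 m X
      by unfold_locales (use assms that in auto)
    show ?thesis
      using dual_increment[OF that(2) Lipschitz]
      unfolding e_def p_def model_error_const_def visit_rate_def .
  qed
  have nonneg: "0 \<le> ?a" "0 \<le> ?b" "0 \<le> e" by (simp_all add: e_def)
  \<comment> \<open>Adding 1 makes every constant strictly positive, also when the explicit ones
    vanish.\<close>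
  have "dual_increment_bound M m X ?a ?b (e + 1) k" "dual_increment_bound M m X (?a + 1) (?b + 1) (e + 1) k"
    if "admm_run D \<phi> c \<beta> \<eta>\<^sub>\<pi> \<eta>\<^sub>V P0 r0 \<kappa> \<alpha> M4 M m X" "1 \<le> k"
    for M :: "'w measure" and m X k
    by (rule dual_increment_bound_mono[OF bound[OF that]]; simp)+
  moreover have "0 < ?a + 1" "0 < ?b + 1" "0 < e + 1" using nonneg by linarith+
  ultimately show ?thesis by blast
qed

end
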